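(* Let $\alpha,\lambda\in(0,\infty)$ and $\beta\in(0,1)$, and let $g$ be the density of the one-sided tempered stable distribution $\eta=\mathrm{TS}(\alpha,\beta,\lambda)$. Then $g$ is of class $C^\infty(\mathbb{R})$ and there exists a point $x_0\in(0,\infty)$ such that $$g'(x)>0\ \text{ for }x\in(-\infty,x_0),\qquad g'(x_0)=0,\qquad g'(x)<0\ \text{ for }x\in(x_0,\infty).$$ Moreover, $$\max\bigg\{\Gamma(1-\beta)\frac{\alpha}{\lambda^{1-\beta}}-\Big(3\,\Gamma(2-\beta)\frac{\alpha}{\lambda^{2-\beta}}\Big)^{1/2},\ \xi_0\bigg\}<x_0<\min\bigg\{\Gamma(1-\beta)\frac{\alpha}{\lambda^{1-\beta}},\ \Big(\frac{\alpha}{1-\beta}\Big)^{1/\beta}\bigg\},$$ where $\xi_0\in(0,\infty)$ denotes the unique solution of the fixed point equation $$\alpha^{1/\beta}\exp\Big(-\frac\lambda\beta\xi_0\Big)=\xi_0.$$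
   Context: For $\alpha,\lambda\in(0,\infty)$ and $\beta\in[0,1)$, the one-sided tempered stable distribution $\mathrm{TS}(\alpha,\beta,\lambda)$ is the infinitely divisible distribution on $\mathbb{R}$ with characteristic function $\varphi(z)=\exp\big(\int_{\mathbb{R}}(e^{izx}-1)F(dx)\big)$, $z\in\mathbb{R}$, where $F(dx)=\frac{\alpha}{x^{1+\beta}}e^{-\lambda x}\mathbf{1}_{(0,\infty)}(x)\,dx$. For $\beta\in(0,1)$ this distribution is selfdecomposable, hence absolutely continuous with respect to Lebesgue measure; $g$ denotes its density on $\mathbb{R}$. $\Gamma$ is the Gamma function.
   Formalization: The printed claim g'(x)>0 on (-∞,x_0) is false, since the distribution lives on [0,∞) and so g'=0 on (-∞,0]; what is proved is g'(x)=0 for x≤0 and g'(x)>0 for x∈(0,x_0), with everything else unchanged. *)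

theory Defs
  imports "HOL-Probability.Probability"
begin

definition infinitely_divisible :: "real measure \<Rightarrow> bool" where
  "infinitely_divisible \<mu> \<longleftrightarrow>
     real_distribution \<mu> \<and>
     (\<forall>n\<ge>1. \<exists>\<nu>. real_distribution \<nu> \<and> \<mu> = ((\<star>) \<nu> ^^ n) (return borel 0))"

definition ts_levy_measure :: "real \<Rightarrow> real \<Rightarrow> real \<Rightarrow> real measure" where
  "ts_levy_measure \<alpha> \<beta> lam =
     density lborel (\<lambda>x. ennreal (\<alpha> / x powr (1 + \<beta>) * exp (- lam * x) * indicator {0<..} x))"

(* A predicate on measures rather than a measure: at most one measure satisfies it, because a
   distribution on the real line is determined by its characteristic function. *)
definition is_tempered_stable :: "real \<Rightarrow> real \<Rightarrow> real \<Rightarrow> real measure \<Rightarrow> bool" where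
  "is_tempered_stable \<alpha> \<beta> lam \<eta> \<longleftrightarrow>
     infinitely_divisible \<eta> \<and>
     (\<forall>z. char \<eta> z = exp (CLINT x | ts_levy_measure \<alpha> \<beta> lam. (iexp (z * x) - 1)))"

(* Densities are unique only up to null sets; a continuous density is unique as a function. *)
definition is_density_of :: "(real \<Rightarrow> real) \<Rightarrow> real measure \<Rightarrow> bool" where
  "is_density_of g \<eta> \<longleftrightarrow>
     g \<in> borel_measurable borel \<and> (\<forall>x. 0 \<le> g x) \<and> \<eta> = density lborel (\<lambda>x. ennreal (g x))"

(* Continuity of the iterated derivatives is automatic, since each of them is differentiable. *)
definition C_infinity :: "(real \<Rightarrow> real) \<Rightarrow> bool" where
  "C_infinity g \<longleftrightarrow> (\<forall>k. (deriv ^^ k) g differentiable_on UNIV)"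

end

(* A selfdecomposable density on the half-line satisfies x g(x) = (g * k)(x) and hence
   x g'(x) + g(x) = (g' * k)(x), where k(y) = alpha y^(-beta) exp(-lam y) decreases from infinity to 0.
   The characteristic function phi decays like exp(-c |z|^beta) and satisfies phi' = i phi K with K the
   Fourier transform of k, so Fourier inversion gives a smooth density and both equations.  The first one
   forces g to vanish on the negative half-line, because g and k are nonnegative.  Let k(xi) = 1.
   Evaluating the second equation at a maximum of g over [0, x] gives g' > 0 on (0, xi].  At the first
   zero M of g' the integral of g'(u) (k(M - u) - 1) over (0, M) vanishes; comparing the integrals at
   x > M with those at M, according to whether k(x - M) is at least 1, shows that g' < 0 beyond M.
   The first equation at M gives M < int_0^M k, hence both upper bounds; the lower bound is the
   Johnson-Rogers inequality between mode, mean and variance. *)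
theory Submission
  imports Defs
begin

text \<open>The level 1 enters through g(x) = int_0^x g': subtracting this from the second equation
  gives x g'(x) = int_0^x g'(u) (k(x - u) - 1) du, and the weight is positive exactly at distances
  below xi. The obstacle is the singularity of k at 0. Suprema of k are useless there, so
  integrability takes their place: the mass of k on (0, e) tends to 0 with e, and on a short window
  this mass is absorbed by the factor x on the left. This is how g is shown to have no zero in the
  open half-line, and why g' cannot become positive immediately to the right of M, where g'(M) = 0
  gives no strict sign to start from. From there the sign is carried on by an infimum argument. The
  moments come from the first equation as well: integrating a test function w against x g(x) gives
  the double integral of w(u + y) g(u) k(y), so that k integrates to the mean and y k(y) to the
  variance.\<close>

section \<open>Strict comparison of Lebesgue integrals\<close>

lemma lborel_integral_pos:
  fixes f :: "real \<Rightarrow> real"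
  assumes int: "integrable lborel f" and nonneg: "AE x in lborel. 0 \<le> f x"
    and "a < b" and pos: "\<And>x. a < x \<Longrightarrow> x < b \<Longrightarrow> 0 < f x"
  shows "0 < integral\<^sup>L lborel f"
proof (rule ccontr)
  assume "\<not> ?thesis"
  moreover have "0 \<le> integral\<^sup>L lborel f"
    using nonneg by (rule integral_nonneg_AE)
  ultimately have "AE x in lborel. f x = 0"
    using integral_nonneg_eq_0_iff_AE[OF int nonneg] by simp
  then have "AE x in lborel. x \<notin> {a<..<b}"
    by eventually_elim (use pos in force)
  then have "emeasure lborel {a<..<b} = 0"
    by (subst AE_iff_measurable[symmetric, where P="\<lambda>x. x \<notin> {a<..<b}"]) auto
  then show False
    using \<open>a < b\<close> by simp
qed

lemma lborel_integral_strict_mono: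
  fixes f h :: "real \<Rightarrow> real"
  assumes "integrable lborel f" "integrable lborel h" "AE x in lborel. f x \<le> h x"
    and "a < b" "\<And>x. a < x \<Longrightarrow> x < b \<Longrightarrow> f x < h x"
  shows "integral\<^sup>L lborel f < integral\<^sup>L lborel h"
  using lborel_integral_pos[of "\<lambda>x. h x - f x" a b] assms by simp

text \<open>Comparisons of integrands containing \<open>k (x - u)\<close> may fail at
  \<open>u = x\<close>, where the convention \<open>k 0 = 0\<close> replaces the singularity; a
  finite exceptional set absorbs such points.\<close>

lemma AE_lborel_finite:
  assumes "\<And>x. x \<notin> S \<Longrightarrow> P x" "finite S"
  shows "AE x in lborel. P (x::real)"
  using assms
  by (intro AE_I'[of S]) (auto simp: finite_imp_null_set_lborel)

lemma integrable_continuous_mult_indicator: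
  fixes f :: "real \<Rightarrow> real"
  assumes "continuous_on UNIV f"
  shows "integrable lborel (\<lambda>x. f x * indicator {a..b} x)"
  using borel_integrable_atLeastAtMost[of a b f] assms
  by (auto simp: continuous_on_eq_continuous_at)

section \<open>Strict unimodality of solutions of the convolution equation\<close>

text \<open>The abstract setting of the shape argument. Since \<open>k\<close> and \<open>g\<close>
  vanish left of 0, the integrals over the whole line in \<open>conv\<close> and
  \<open>conv'\<close> effectively run from 0 to \<open>x\<close>. The point \<open>\<xi>\<close> is
  where \<open>k\<close> crosses the level 1.\<close>

locale convolution_density =
  fixes k g g' :: "real \<Rightarrow> real" and \<xi> :: real
  assumes k_zero: "\<And>y. y \<le> 0 \<Longrightarrow> k y = 0"
    and k_pos: "\<And>y. 0 < y \<Longrightarrow> 0 < k y"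
    and k_strict_antimono: "\<And>x y. 0 < x \<Longrightarrow> x < y \<Longrightarrow> k y < k x"
    and k_integrable: "integrable lborel k"
    and xi_pos: "0 < \<xi>" and k_xi: "k \<xi> = 1"
    and g_deriv: "\<And>x. (g has_real_derivative g' x) (at x)"
    and g'_cont: "continuous_on UNIV g'"
    and g_nonneg: "\<And>x. 0 \<le> g x"
    and g_zero: "\<And>x. x \<le> 0 \<Longrightarrow> g x = 0"
    and g_integrable: "integrable lborel g" and g_integral: "integral\<^sup>L lborel g = 1"
    and conv: "\<And>x. x * g x = (\<integral>u. g u * k (x - u) \<partial>lborel)"
    and conv': "\<And>x. g x + x * g' x = (\<integral>u. g' u * k (x - u) \<partial>lborel)"
begin

section \<open>Kernel estimates and integrability of the convolutions\<close>

lemma k_nonneg: "0 \<le> k y"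
  using k_pos[of y] k_zero[of y] by (cases "0 < y") auto

lemma k_antimono: "0 < x \<Longrightarrow> x \<le> y \<Longrightarrow> k y \<le> k x"
  using k_strict_antimono[of x y] by (cases "x = y") auto

lemma k_measurable [measurable]: "k \<in> borel_measurable borel"
  using k_integrable by auto

lemma g_cont: "continuous_on UNIV g"
  using g_deriv by (meson DERIV_atLeastAtMost_imp_continuous_on DERIV_continuous_on has_field_derivative_at_within)

lemma g_measurable [measurable]: "g \<in> borel_measurable borel"
  using g_cont by (rule borel_measurable_continuous_onI)

lemma g'_measurable [measurable]: "g' \<in> borel_measurable borel"
  using g'_cont by (rule borel_measurable_continuous_onI)

lemma g'_zero: "g' x = 0" if "x \<le> 0"
proof -
  have neg: "g' x = 0" if "x < 0" for x
  proof -
    have "(g has_real_derivative 0) (at x)"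
      by (rule has_field_derivative_transform_within_open[of "\<lambda>_. 0" 0 x "{..<0}"])
         (use that in \<open>auto simp: g_zero\<close>)
    then show ?thesis
      using g_deriv DERIV_unique by blast
  qed
  have "g' 0 = 0"
  proof -
    have "(g' \<longlongrightarrow> g' 0) (at_left 0)"
      using g'_cont by (auto simp: continuous_on_def intro: tendsto_within_subset)
    moreover have "(g' \<longlongrightarrow> 0) (at_left 0)"
      by (rule tendsto_eventually) (auto simp: eventually_at_filter neg)
    ultimately show ?thesis
      using tendsto_unique trivial_limit_at_left_real by blast
  qed
  with neg that show ?thesis by (cases "x = 0") auto
qed

lemma k_shift_integrable: "integrable lborel (\<lambda>u. k (x - u))"
  using lborel_integrable_real_affine[OF k_integrable, of "-1" x] by simp

text \<open>Both factors are cut off, \<open>h\<close> to the left of 0 and the kernel to the right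
  of \<open>x\<close>; on the remaining compact interval \<open>h\<close> is bounded, so a multiple
  of the shifted kernel dominates.\<close>

lemma cont_times_k_integrable:
  assumes h: "continuous_on UNIV h" "\<And>x. x \<le> 0 \<Longrightarrow> h x = 0"
  shows "integrable lborel (\<lambda>u. h u * k (x - u))"
proof -
  have [measurable]: "h \<in> borel_measurable borel"
    using h(1) by (rule borel_measurable_continuous_onI)
  have "bounded (h ` {0..x})"
    using h(1) by (intro compact_imp_bounded compact_continuous_image) (auto intro: continuous_on_subset)
  then obtain B where B: "\<And>u. u \<in> {0..x} \<Longrightarrow> \<bar>h u\<bar> \<le> B"
    by (fastforce simp: bounded_iff)
  show ?thesis
  proof (rule Bochner_Integration.integrable_bound)
    show "integrable lborel (\<lambda>u. B * k (x - u))"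
      using k_shift_integrable by simp
    show "AE u in lborel. norm (h u * k (x - u)) \<le> norm (B * k (x - u))"
    proof (rule AE_I2)
      fix u
      show "norm (h u * k (x - u)) \<le> norm (B * k (x - u))"
        using B[of u] h(2)[of u] k_zero[of "x - u"] k_nonneg[of "x - u"]
        by (cases "u \<in> {0..x}"; cases "x < u")
          (auto simp: abs_mult intro!: mult_right_mono intro: order_trans[OF _ abs_ge_self])
    qed
  qed measurable
qed

lemma gk_integrable: "integrable lborel (\<lambda>u. g u * k (x - u))"
  using g_cont g_zero by (rule cont_times_k_integrable)

lemma g'k_integrable: "integrable lborel (\<lambda>u. g' u * k (x - u))"
  using g'_cont g'_zero by (rule cont_times_k_integrable)

lemma g'_indicator_integrable: "integrable lborel (\<lambda>u. g' u * indicator {a..b} u)"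
  using g'_cont by (rule integrable_continuous_mult_indicator)

lemma integral_g':
  assumes "a \<le> b"
  shows "(\<integral>u. g' u * indicator {a..b} u \<partial>lborel) = g b - g a"
  using assms g_deriv g'_cont
  by (intro integral_FTC_Icc_real) (auto simp: continuous_on_eq_continuous_at)

text \<open>Dominated convergence on shrinking windows. The small mass near the singularity drives
  the absorption arguments in \<open>g_pos\<close> and
  \<open>g'_nonpos_right_of_critical\<close>.\<close>

lemma k_initial_small:
  assumes "0 < c"
  obtains e where "0 < e" "(\<integral>y. k y * indicator {0<..<e} y \<partial>lborel) < c"
proof -
  have "(\<lambda>n. \<integral>y. k y * indicator {0<..<1 / real (Suc n)} y \<partial>lborel) \<longlonglongrightarrow> (\<integral>y. 0 \<partial>(lborel::real measure))"
  proof (rule integral_dominated_convergence[where w=k])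
    show "AE y in lborel. (\<lambda>n. k y * indicator {0<..<1 / real (Suc n)} y) \<longlonglongrightarrow> 0"
    proof (rule AE_I2)
      fix y :: real
      show "(\<lambda>n. k y * indicator {0<..<1 / real (Suc n)} y) \<longlonglongrightarrow> 0"
      proof (cases "0 < y")
        case True
        then have "eventually (\<lambda>n. 1 / real (Suc n) < y) sequentially"
          using LIMSEQ_inverse_real_of_nat by (auto dest!: order_tendstoD(2) simp: inverse_eq_divide)
        then have "eventually (\<lambda>n. k y * indicator {0<..<1 / real (Suc n)} y = 0) sequentially"
          by (rule eventually_mono) (simp add: indicator_def)
        then show ?thesis
          by (rule tendsto_eventually)
      qed (auto simp: k_zero)
    qed
  qed (auto simp: k_integrable k_nonneg indicator_def)
  then have "eventually (\<lambda>n. (\<integral>y. k y * indicator {0<..<1 / real (Suc n)} y \<partial>lborel) < c) sequentially"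
    using assms by (auto dest: order_tendstoD(2))
  then obtain n where "(\<integral>y. k y * indicator {0<..<1 / real (Suc n)} y \<partial>lborel) < c"
    by (auto simp: eventually_sequentially)
  then show thesis
    by (intro that[of "1 / real (Suc n)"]) auto
qed

lemma k_window:
  "(\<integral>u. k (x - u) * indicator {a<..<x} u \<partial>lborel) = (\<integral>y. k y * indicator {0<..<x - a} y \<partial>lborel)"
  by (subst lborel_integral_real_affine[where c="-1" and t=x])
     (auto intro!: Bochner_Integration.integral_cong simp: indicator_def)

lemma k_indicator_integrable [simp]: "integrable lborel (\<lambda>y. k y * indicator {a<..<b} y)"
  using integrable_real_mult_indicator[OF _ k_integrable, of "{a<..<b}"] by simp

lemma k_shift_indicator_integrable [simp]: "integrable lborel (\<lambda>u. k (x - u) * indicator {a<..<b} u)"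
  using integrable_real_mult_indicator[OF _ k_shift_integrable, of "{a<..<b}"] by simp

lemma k_window_mono:
  assumes "a \<le> b"
  shows "(\<integral>y. k y * indicator {0<..<a} y \<partial>lborel) \<le> (\<integral>y. k y * indicator {0<..<b} y \<partial>lborel)"
  using assms by (intro integral_mono k_indicator_integrable) (auto simp: indicator_def k_nonneg)

section \<open>Positivity of g on the open half-line, and the convolution at a maximum point\<close>

text \<open>The convolution of nonnegative factors vanishes at \<open>x\<close>, and
  \<open>k\<close> is positive on the open half-line, so continuity of \<open>g\<close> leaves no
  positive value to the left: zeros propagate leftwards.\<close>

lemma g_eq_0_left:
  assumes "0 < x" "g x = 0" "u < x"
  shows "g u = 0"
proof (rule ccontr)
  assume "g u \<noteq> 0"
  then have "0 < g u" using g_nonneg[of u] by simp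
  have "open {v. 0 < g v}"
    using g_cont by (intro open_Collect_less) auto
  then have "open ({v. 0 < g v} \<inter> {..<x})"
    by auto
  moreover have "u \<in> {v. 0 < g v} \<inter> {..<x}"
    using \<open>0 < g u\<close> assms by auto
  ultimately obtain e where e: "0 < e" "ball u e \<subseteq> {v. 0 < g v} \<inter> {..<x}"
    by (meson openE)
  have "0 < (\<integral>u. g u * k (x - u) \<partial>lborel)"
  proof (rule lborel_integral_pos[OF gk_integrable, of _ "u - e" "u + e"])
    fix v assume "u - e < v" "v < u + e"
    then have "v \<in> ball u e" by (auto simp: dist_real_def)
    then show "0 < g v * k (x - v)"
      using e(2) by (auto intro!: mult_pos_pos k_pos)
  qed (use e in \<open>auto simp: g_nonneg k_nonneg\<close>)
  with conv[of x] assms show False by simp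
qed

text \<open>Zeros propagate leftwards, so they would fill an initial interval with supremum
  \<open>c\<close>. On a window from \<open>c\<close> to \<open>c + e\<close> carrying kernel mass
  below \<open>c\<close>, \<open>conv\<close> at a maximum point \<open>m\<close> gives
  \<open>m * g m \<le> g m * mass\<close> with \<open>mass < c \<le> m\<close>. Hence
  \<open>g\<close> vanishes on the window, and \<open>c\<close> was not the supremum.\<close>

lemma g_pos:
  assumes "0 < x"
  shows "0 < g x"
proof (rule ccontr)
  assume "\<not> 0 < g x"
  then have gx: "g x = 0" using g_nonneg[of x] by simp
  have "\<exists>x1. 0 < g x1"
  proof (rule ccontr)
    assume "\<not> ?thesis"
    then have "g = (\<lambda>_. 0)"
      using g_nonneg by (auto simp: fun_eq_iff not_less intro!: antisym)
    with g_integral show False by simp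
  qed
  then obtain x1 where x1: "0 < g x1" by blast
  define S where "S = {y. 0 < y \<and> g y = 0}"
  have S_bdd: "y \<le> x1" if "y \<in> S" for y
    using g_eq_0_left[of y x1] that x1 by (force simp: S_def)
  have "x \<in> S" using gx assms by (simp add: S_def)
  define c where "c = Sup S"
  have bdd: "bdd_above S" using S_bdd by (auto simp: bdd_above_def)
  have c_ge: "y \<le> c" if "y \<in> S" for y
    unfolding c_def using that bdd by (rule cSup_upper)
  have "0 < c" using c_ge[OF \<open>x \<in> S\<close>] assms by simp
  have g_below: "g u = 0" if uc: "u < c" for u
  proof -
    obtain y where "y \<in> S" "u < y"
      using uc \<open>x \<in> S\<close> less_cSupD[of S u] unfolding c_def by blast
    then show ?thesis using g_eq_0_left[of y u] by (auto simp: S_def)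
  qed
  obtain e where e: "0 < e" "(\<integral>y. k y * indicator {0<..<e} y \<partial>lborel) < c"
    using k_initial_small[OF \<open>0 < c\<close>] .
  have "\<exists>m\<in>{c..c+e}. \<forall>y\<in>{c..c+e}. g y \<le> g m"
    using e(1) g_cont by (intro continuous_attains_sup) (auto intro: continuous_on_subset)
  then obtain m where m: "m \<in> {c..c+e}" "\<And>y. y \<in> {c..c+e} \<Longrightarrow> g y \<le> g m"
    by blast
  have "m * g m = (\<integral>u. g u * k (m - u) \<partial>lborel)"
    by (rule conv)
  also have "\<dots> \<le> (\<integral>u. g m * (k (m - u) * indicator {c<..<m} u) \<partial>lborel)"
  proof (rule integral_mono_AE)
    show "AE u in lborel. g u * k (m - u) \<le> g m * (k (m - u) * indicator {c<..<m} u)"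
    proof (rule AE_lborel_finite[of "{c}"])
      fix u assume "u \<notin> {c}"
      then consider "u < c" | "u \<in> {c<..<m}" | "m \<le> u" by force
      then show "g u * k (m - u) \<le> g m * (k (m - u) * indicator {c<..<m} u)"
        by cases (use m g_below k_zero k_nonneg in \<open>auto intro!: mult_right_mono\<close>)
    qed simp
  qed (auto intro: gk_integrable)
  also have "\<dots> = g m * (\<integral>y. k y * indicator {0<..<m - c} y \<partial>lborel)"
    by (simp add: k_window)
  also have "\<dots> \<le> g m * (\<integral>y. k y * indicator {0<..<e} y \<partial>lborel)"
    using m(1) by (intro mult_left_mono k_window_mono g_nonneg) auto
  finally have "m * g m \<le> g m * (\<integral>y. k y * indicator {0<..<e} y \<partial>lborel)" .
  moreover have "(\<integral>y. k y * indicator {0<..<e} y \<partial>lborel) < m"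
    using e(2) m(1) by auto
  ultimately have "g m = 0"
    using g_nonneg[of m] by (auto simp: mult.commute[of m] mult_le_cancel_left)
  then have "g (c + e) = 0"
    using m(2)[of "c + e"] e(1) g_nonneg[of "c + e"] by auto
  then have "c + e \<in> S"
    using e(1) \<open>0 < c\<close> by (simp add: S_def)
  with c_ge[of "c + e"] e(1) show False by auto
qed

text \<open>Truncating the singular kernel at height \<open>N\<close> makes the second mean value theorem
  applicable; dominated convergence then removes the truncation.\<close>

lemma convolution_at_argmax_ge:
  assumes "0 < m" and max: "\<And>u. 0 \<le> u \<Longrightarrow> u \<le> m \<Longrightarrow> g u \<le> g m"
  shows "g m * k m \<le> (\<integral>u. g' u * k (m - u) \<partial>lborel)"
proof -
  \<comment> \<open>Capping at \<open>k m + real n\<close> bounds the weight. At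
    \<open>u = m\<close> it takes the value of the cap instead of \<open>k 0 = 0\<close>, which
    keeps it increasing up to the endpoint.\<close>
  define kN where "kN n u = (if u < m then min (k (m - u)) (k m + real n) else k m + real n)" for n u
  have [measurable]: "kN n \<in> borel_measurable borel" for n
    unfolding kN_def by measurable
  have int: "integrable lborel (\<lambda>u. (g' u * indicator {0..m} u) * kN n u)" for n
  proof (rule Bochner_Integration.integrable_bound)
    show "integrable lborel (\<lambda>u. (g' u * indicator {0..m} u) * (k m + real n))"
      using g'_indicator_integrable by simp
    show "AE u in lborel. norm ((g' u * indicator {0..m} u) * kN n u) \<le> norm ((g' u * indicator {0..m} u) * (k m + real n))"
      using k_nonneg by (auto simp: abs_mult kN_def intro!: AE_I2 mult_left_mono)
  qed measurable
  have ge: "g m * k m \<le> (\<integral>u. (g' u * indicator {0..m} u) * kN n u \<partial>lborel)" for n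
  proof -
    have g'_int: "(g' has_integral (g b - g a)) {a..b}" if "a \<le> b" for a b
      using that g_deriv by (intro fundamental_theorem_of_calculus)
        (auto simp: has_real_derivative_iff_has_vector_derivative[symmetric] intro: has_field_derivative_at_within)
    have mono: "kN n u \<le> kN n v" if "0 \<le> u" "u \<le> v" "v \<le> m" for u v
    proof -
      have "k (m - u) \<le> k (m - v)" if "v < m"
        using that \<open>u \<le> v\<close> by (intro k_antimono) auto
      then show ?thesis using that by (auto simp: kN_def min_def)
    qed
    \<comment> \<open>The increasing weight is replaced by its end values \<open>k m\<close> and
      \<open>k m + real n\<close>, split at \<open>c\<close>. The integral becomes
      \<open>k m * g m + real n * (g m - g c)\<close>, and maximality of \<open>g m\<close> makes
      the second term nonnegative.\<close>
    obtain c where c: "c \<in> {0..m}"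
      and hi: "((\<lambda>u. kN n u * g' u) has_integral (kN n 0 * integral {0..c} g' + kN n m * integral {c..m} g')) {0..m}"
      using second_mean_value_theorem_full[of g' 0 m "kN n"] g'_int[of 0 m] mono \<open>0 < m\<close>
      by (auto simp: has_integral_integrable)
    have "kN n 0 = k m" "kN n m = k m + real n"
      using \<open>0 < m\<close> by (auto simp: kN_def)
    moreover have "integral {0..c} g' = g c" "integral {c..m} g' = g m - g c"
      using c g'_int[of 0 c] g'_int[of c m] by (auto simp: integral_unique g_zero)
    ultimately have "kN n 0 * integral {0..c} g' + kN n m * integral {c..m} g' = k m * g m + real n * (g m - g c)"
      by (simp only:) (simp add: algebra_simps)
    with hi have hi': "((\<lambda>u. kN n u * g' u) has_integral (k m * g m + real n * (g m - g c))) {0..m}"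
      by simp
    have "((\<lambda>u. (g' u * indicator {0..m} u) * kN n u) has_integral
        (\<integral>u. (g' u * indicator {0..m} u) * kN n u \<partial>lborel)) UNIV"
      by (rule has_integral_integral_lborel[OF int])
    then have "((\<lambda>u. if u \<in> {0..m} then kN n u * g' u else 0) has_integral
        (\<integral>u. (g' u * indicator {0..m} u) * kN n u \<partial>lborel)) UNIV"
      by (rule has_integral_eq[rotated]) (auto simp: indicator_def)
    then have "((\<lambda>u. kN n u * g' u) has_integral
        (\<integral>u. (g' u * indicator {0..m} u) * kN n u \<partial>lborel)) {0..m}"
      by (simp only: has_integral_restrict_UNIV)
    then have "(\<integral>u. (g' u * indicator {0..m} u) * kN n u \<partial>lborel) = k m * g m + real n * (g m - g c)"
      using hi' by (rule has_integral_unique)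
    moreover have "0 \<le> real n * (g m - g c)"
      using max[of c] c by (intro mult_nonneg_nonneg) auto
    ultimately show ?thesis by (simp add: mult.commute)
  qed
  have "(\<lambda>n. \<integral>u. (g' u * indicator {0..m} u) * kN n u \<partial>lborel) \<longlonglongrightarrow> (\<integral>u. g' u * k (m - u) \<partial>lborel)"
  proof (rule integral_dominated_convergence[where w="\<lambda>u. norm (g' u * k (m - u))"])
    show "integrable lborel (\<lambda>u. norm (g' u * k (m - u)))"
      using g'k_integrable by (rule integrable_norm)
    show "AE u in lborel. (\<lambda>n. (g' u * indicator {0..m} u) * kN n u) \<longlonglongrightarrow> g' u * k (m - u)"
    proof (rule AE_lborel_finite[of "{m}"])
      fix u assume "u \<notin> {m}"
      then consider "u \<le> 0" | "0 < u" "u < m" | "m < u" by force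
      then show "(\<lambda>n. (g' u * indicator {0..m} u) * kN n u) \<longlonglongrightarrow> g' u * k (m - u)"
      proof cases
        case 2
        obtain N where N: "k (m - u) \<le> real N"
          using real_arch_simple by blast
        have "(g' u * indicator {0..m} u) * kN n u = g' u * k (m - u)" if "N \<le> n" for n
          using 2 that N k_nonneg[of m] by (auto simp: kN_def min_def)
        then show ?thesis
          by (intro tendsto_eventually) (auto simp: eventually_sequentially)
      qed (auto simp: g'_zero k_zero)
    qed simp
    show "AE u in lborel. norm ((g' u * indicator {0..m} u) * kN n u) \<le> norm (g' u * k (m - u))" for n
    proof (rule AE_lborel_finite[of "{m}"])
      fix u assume "u \<notin> {m}"
      then show "norm ((g' u * indicator {0..m} u) * kN n u) \<le> norm (g' u * k (m - u))"
        using k_nonneg[of m] k_nonneg[of "m - u"]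
        by (auto simp: abs_mult indicator_def kN_def intro!: mult_left_mono)
    qed simp
  qed measurable
  then show ?thesis
    using ge by (intro LIMSEQ_le_const) auto
qed

section \<open>The sign of g' up to the first critical point\<close>

lemma times_g'_eq:
  "x * g' x = (\<integral>u. g' u * k (x - u) - g' u * indicator {0..x} u \<partial>lborel)" if "0 \<le> x"
  using conv'[of x] integral_g'[of 0 x] that
  by (simp add: g'k_integrable g'_indicator_integrable g_zero)

text \<open>At a maximum point \<open>m\<close> of \<open>g\<close> on \<open>{0..x}\<close>,
  \<open>convolution_at_argmax_ge\<close> and \<open>k m > k \<xi> = 1\<close> give
  \<open>g' m > 0\<close>. An interior maximum would have \<open>g' m = 0\<close>, so the maximum
  sits at \<open>x\<close> itself.\<close>

lemma g'_pos_below_xi: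
  assumes "0 < x" "x < \<xi>"
  shows "0 < g' x"
proof -
  have "\<exists>m\<in>{0..x}. \<forall>y\<in>{0..x}. g y \<le> g m"
    using assms g_cont by (intro continuous_attains_sup) (auto intro: continuous_on_subset)
  then obtain m where m: "m \<in> {0..x}" "\<And>y. y \<in> {0..x} \<Longrightarrow> g y \<le> g m"
    by blast
  have "m > 0"
    using m(2)[of x] m(1) g_pos[of x] assms g_zero[of 0] by (cases "m = 0") auto
  have "g m < g m * k m"
    using k_strict_antimono[of m \<xi>] m(1) assms \<open>0 < m\<close> k_xi g_pos[of m] by auto
  also have "\<dots> \<le> (\<integral>u. g' u * k (m - u) \<partial>lborel)"
    using \<open>0 < m\<close> m by (intro convolution_at_argmax_ge) auto
  finally have pos: "0 < g' m"
    using conv'[of m] \<open>0 < m\<close> zero_less_mult_pos[of m "g' m"] by simp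
  show ?thesis
  proof (cases "m = x")
    case False
    have "g' m = 0"
    proof (rule DERIV_local_max[OF g_deriv])
      show "0 < min m (x - m)" using False \<open>0 < m\<close> m(1) by auto
      show "\<forall>y. \<bar>m - y\<bar> < min m (x - m) \<longrightarrow> g y \<le> g m"
        using m(1) by (auto intro!: m(2) simp: abs_less_iff)
    qed
    with pos show ?thesis by simp
  qed (use pos in simp)
qed

text \<open>At \<open>\<xi>\<close> the previous estimate loses its strictness, because the kernel
  has come down to 1. Instead, the integrand of \<open>times_g'_eq\<close> is positive for
  \<open>0 < u < \<xi>\<close>, where \<open>g' u > 0\<close> is known and
  \<open>k (\<xi> - u) > 1\<close>.\<close>

lemma g'_pos_xi: "0 < g' \<xi>"
proof -
  have "0 < (\<integral>u. g' u * k (\<xi> - u) - g' u * indicator {0..\<xi>} u \<partial>lborel)"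
  proof (rule lborel_integral_pos[of _ 0 \<xi>])
    have pos: "0 < g' u * k (\<xi> - u) - g' u * indicator {0..\<xi>} u" if "0 < u" "u < \<xi>" for u
      using that k_strict_antimono[of "\<xi> - u" \<xi>] g'_pos_below_xi[of u] k_xi by auto
    then show "0 < u \<Longrightarrow> u < \<xi> \<Longrightarrow> 0 < g' u * k (\<xi> - u) - g' u * indicator {0..\<xi>} u" for u .
    show "AE u in lborel. 0 \<le> g' u * k (\<xi> - u) - g' u * indicator {0..\<xi>} u"
    proof (rule AE_lborel_finite[of "{\<xi>}"])
      fix u assume "u \<notin> {\<xi>}"
      then consider "u \<le> 0" | "0 < u" "u < \<xi>" | "\<xi> < u" by force
      then show "0 \<le> g' u * k (\<xi> - u) - g' u * indicator {0..\<xi>} u"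
        using pos[of u] by cases (auto simp: g'_zero k_zero)
    qed simp
  qed (use xi_pos in \<open>auto intro: g'k_integrable g'_indicator_integrable\<close>)
  then show ?thesis
    using times_g'_eq[of \<xi>] xi_pos zero_less_mult_pos[of \<xi> "g' \<xi>"] by simp
qed

text \<open>The conjunct \<open>\<xi> < M\<close> already records the fixed-point lower bound on the
  mode.\<close>

definition first_critical :: "real \<Rightarrow> bool" where
  "first_critical M \<longleftrightarrow> \<xi> < M \<and> (\<forall>u. 0 < u \<and> u < M \<longrightarrow> 0 < g' u) \<and> g' M = 0"

text \<open>If \<open>g'\<close> stayed positive beyond \<open>\<xi>\<close>, then \<open>g\<close>
  would remain above \<open>g \<xi> > 0\<close> there, against total mass 1. The least point with
  \<open>g' \<le> 0\<close> is then a zero of \<open>g'\<close> by continuity from the left.\<close>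

lemma first_critical_exists: "\<exists>M. first_critical M"
proof -
  define S where "S = {x. \<xi> \<le> x \<and> g' x \<le> 0}"
  have "S \<noteq> {}"
  proof
    assume "S = {}"
    then have pos: "0 < g' x" if "\<xi> \<le> x" for x
      using that by (force simp: S_def)
    have mono: "g \<xi> \<le> g x" if "\<xi> \<le> x" for x
      by (rule DERIV_nonneg_imp_nondecreasing[OF that])
         (use g_deriv pos in \<open>auto intro: less_imp_le\<close>)
    have bound: "real n * g \<xi> \<le> 1" for n
    proof -
      have "real n * g \<xi> = (\<integral>x. g \<xi> * indicator {\<xi>..\<xi> + real n} x \<partial>lborel)"
        by simp
      also have "\<dots> \<le> (\<integral>x. g x \<partial>lborel)"
        using mono g_nonneg g_integrable
        by (intro integral_mono integrable_continuous_mult_indicator) (auto simp: indicator_def)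
      finally show ?thesis using g_integral by simp
    qed
    obtain n where "1 < real n * g \<xi>"
      using g_pos[OF xi_pos] reals_Archimedean3 by blast
    with bound[of n] show False by simp
  qed
  have "closed S"
    unfolding S_def using g'_cont
    by (intro closed_Collect_conj closed_Collect_le continuous_on_const continuous_on_id)
  have bdd: "bdd_below S" by (auto simp: S_def bdd_below_def)
  define M where "M = Inf S"
  have "M \<in> S"
    unfolding M_def using \<open>S \<noteq> {}\<close> bdd \<open>closed S\<close> by (rule closed_contains_Inf)
  then have M: "\<xi> < M" "g' M \<le> 0"
    using g'_pos_xi by (auto simp: S_def le_less)
  have pos: "0 < g' u" if "0 < u" "u < M" for u
  proof (cases "u < \<xi>")
    case False
    have "u \<notin> S"
      using cInf_lower[OF _ bdd, of u] that by (auto simp: M_def)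
    then show ?thesis using False by (auto simp: S_def)
  qed (use that g'_pos_below_xi in auto)
  have "0 \<le> g' M"
  proof (rule tendsto_lowerbound)
    show "(g' \<longlongrightarrow> g' M) (at_left M)"
      using g'_cont by (auto simp: continuous_on_def intro: tendsto_within_subset)
    show "eventually (\<lambda>u. 0 \<le> g' u) (at_left M)"
      using M xi_pos pos by (auto simp: eventually_at_left intro!: exI[of _ 0] less_imp_le)
  qed simp
  with M pos show ?thesis by (auto simp: first_critical_def)
qed

section \<open>Strict decrease beyond the first critical point\<close>

text \<open>The induction step for \<open>g'_neg_above\<close>: a weak sign between \<open>M\<close>
  and \<open>x\<close> is upgraded to a strict sign at \<open>x\<close>, which continuity can then
  carry further.\<close>

lemma g'_neg_step:
  assumes M: "first_critical M" and "M < x" and nonpos: "\<And>u. M < u \<Longrightarrow> u < x \<Longrightarrow> g' u \<le> 0"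
  shows "g' x < 0"
proof -
  have pos: "0 < g' u" if "0 < u" "u < M" for u
    using M that by (auto simp: first_critical_def)
  have "g' M = 0" "0 < M" using M xi_pos by (auto simp: first_critical_def)
  have "x > 0" using \<open>0 < M\<close> \<open>M < x\<close> by simp
  show ?thesis
  proof (cases "1 \<le> k (x - M)")
    case True
    \<comment> \<open>To the right of \<open>M\<close> the weight \<open>k (x - u) - 1\<close> is
      nonnegative and meets \<open>g' \<le> 0\<close>; to the left it has shrunk from
      \<open>k (M - u) - 1\<close> and meets \<open>g' > 0\<close>. So the integral of
      \<open>times_g'_eq\<close> drops below its value 0 at \<open>M\<close>.\<close>
    have strict: "g' u * k (x - u) - g' u * indicator {0..x} u < g' u * k (M - u) - g' u * indicator {0..M} u"
      if "0 < u" "u < M" for u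
      using that k_strict_antimono[of "M - u" "x - u"] pos[of u] \<open>M < x\<close> by simp
    have "(\<integral>u. g' u * k (x - u) - g' u * indicator {0..x} u \<partial>lborel)
        < (\<integral>u. g' u * k (M - u) - g' u * indicator {0..M} u \<partial>lborel)"
    proof (rule lborel_integral_strict_mono[where a=0 and b=M])
      show "AE u in lborel. g' u * k (x - u) - g' u * indicator {0..x} u
          \<le> g' u * k (M - u) - g' u * indicator {0..M} u"
      proof (rule AE_lborel_finite[of "{M, x}"])
        fix u assume "u \<notin> {M, x}"
        then consider "u \<le> 0" | "0 < u" "u < M" | "M < u" "u < x" | "x < u" by force
        then show "g' u * k (x - u) - g' u * indicator {0..x} u
            \<le> g' u * k (M - u) - g' u * indicator {0..M} u"
        proof cases
          case 3
          then have "1 \<le> k (x - u)"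
            using True k_antimono[of "x - u" "x - M"] by simp
          then have "g' u * (k (x - u) - 1) \<le> 0"
            using nonpos[of u] 3 by (intro mult_nonpos_nonneg) auto
          with 3 \<open>0 < M\<close> show ?thesis by (simp add: k_zero algebra_simps)
        qed (use strict \<open>M < x\<close> in \<open>auto simp: g'_zero k_zero intro: less_imp_le\<close>)
      qed simp
    qed (use strict \<open>0 < M\<close> in \<open>auto intro: g'k_integrable g'_indicator_integrable\<close>)
    also have "\<dots> = 0"
      using times_g'_eq[of M] \<open>0 < M\<close> \<open>g' M = 0\<close> by simp
    finally have "x * g' x < 0"
      using times_g'_eq[of x] \<open>0 < x\<close> by simp
    then show ?thesis using \<open>0 < x\<close> by (simp add: mult_less_0_iff)
  next
    case False
    \<comment> \<open>The kernel is compared with the constant \<open>k (x - M) < 1\<close>: it lies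
      below for \<open>u < M\<close>, where \<open>g' > 0\<close>, and above between
      \<open>M\<close> and \<open>x\<close>, where \<open>g' \<le> 0\<close>. The constant
      integrates to \<open>k (x - M) * g x \<le> g x\<close>, so \<open>conv'\<close> leaves
      \<open>x * g' x < 0\<close>.\<close>
    have strict: "g' u * k (x - u) < k (x - M) * (g' u * indicator {0..x} u)" if "0 < u" "u < M" for u
      using that k_strict_antimono[of "x - M" "x - u"] pos[of u] \<open>M < x\<close> by simp
    have "(\<integral>u. g' u * k (x - u) \<partial>lborel) < (\<integral>u. k (x - M) * (g' u * indicator {0..x} u) \<partial>lborel)"
    proof (rule lborel_integral_strict_mono[where a=0 and b=M])
      show "AE u in lborel. g' u * k (x - u) \<le> k (x - M) * (g' u * indicator {0..x} u)"
      proof (rule AE_lborel_finite[of "{M, x}"])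
        fix u assume "u \<notin> {M, x}"
        then consider "u \<le> 0" | "0 < u" "u < M" | "M < u" "u < x" | "x < u" by force
        then show "g' u * k (x - u) \<le> k (x - M) * (g' u * indicator {0..x} u)"
        proof cases
          case 3
          then have "k (x - M) \<le> k (x - u)"
            by (intro k_antimono) auto
          then have "g' u * (k (x - u) - k (x - M)) \<le> 0"
            using nonpos[of u] 3 by (intro mult_nonpos_nonneg) auto
          with 3 \<open>0 < M\<close> show ?thesis by (simp add: algebra_simps)
        qed (use strict \<open>M < x\<close> in \<open>auto simp: g'_zero k_zero intro: less_imp_le\<close>)
      qed simp
    qed (use strict \<open>0 < M\<close> in \<open>auto intro: g'k_integrable g'_indicator_integrable\<close>)
    also have "\<dots> = k (x - M) * g x"
      using integral_g'[of 0 x] \<open>0 < x\<close> by (simp add: g_zero)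
    also have "\<dots> \<le> g x"
      using False g_nonneg[of x] k_nonneg[of "x - M"] by (auto intro: mult_left_le_one_le)
    finally have "x * g' x < 0"
      using conv'[of x] by simp
    then show ?thesis using \<open>0 < x\<close> by (simp add: mult_less_0_iff)
  qed
qed

text \<open>Starts the induction, since \<open>g' M = 0\<close> has no strict sign. If the maximum
  of \<open>g'\<close> over a window right of \<open>M\<close>, attained at \<open>x\<close>, were
  positive, comparing \<open>times_g'_eq\<close> at \<open>x\<close> and at \<open>M\<close> would
  give \<open>x * g' x \<le> g' x * mass < g' x * M\<close>, with \<open>mass\<close> the small
  initial mass of \<open>k\<close>.\<close>

lemma g'_nonpos_right_of_critical:
  assumes M: "first_critical M"
  obtains e where "0 < e" "\<And>u. M \<le> u \<Longrightarrow> u \<le> M + e \<Longrightarrow> g' u \<le> 0"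
proof -
  have pos: "0 < g' u" if "0 < u" "u < M" for u
    using M that by (auto simp: first_critical_def)
  have "g' M = 0" "0 < M" using M xi_pos by (auto simp: first_critical_def)
  obtain d where d: "0 < d" "(\<integral>y. k y * indicator {0<..<d} y \<partial>lborel) < M"
    using k_initial_small[OF \<open>0 < M\<close>] .
  \<comment> \<open>\<open>d\<close> keeps the kernel mass below \<open>M\<close>;
    \<open>\<xi>\<close> keeps \<open>k (x - u) \<ge> 1\<close> within the window, so that
    \<open>g' u \<le> g' x\<close> may be multiplied by \<open>k (x - u) - 1\<close>.\<close>
  define e where "e = min d \<xi>"
  have e: "0 < e" "e \<le> \<xi>" using d(1) xi_pos by (auto simp: e_def)
  have k_e: "(\<integral>y. k y * indicator {0<..<e} y \<partial>lborel) < M"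
    using k_window_mono[of e d] d(2) by (simp add: e_def)
  have "\<exists>x\<in>{M..M+e}. \<forall>y\<in>{M..M+e}. g' y \<le> g' x"
    using e(1) g'_cont by (intro continuous_attains_sup) (auto intro: continuous_on_subset)
  then obtain x where x: "x \<in> {M..M+e}" and max: "\<And>y. y \<in> {M..M+e} \<Longrightarrow> g' y \<le> g' x"
    by blast
  have "0 \<le> g' x" using max[of M] e(1) \<open>g' M = 0\<close> by simp
  have "g' x \<le> 0"
  proof (rule ccontr)
    assume "\<not> g' x \<le> 0"
    then have gx: "0 < g' x" by simp
    then have "M < x" using x \<open>g' M = 0\<close> by (cases "x = M") auto
    let ?L = "\<lambda>u. g' u * k (x - u) - g' u * indicator {0..x} u"
    let ?R = "\<lambda>u. g' u * k (M - u) - g' u * indicator {0..M} u"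
    have "x * g' x = (\<integral>u. ?L u \<partial>lborel)"
      using times_g'_eq[of x] \<open>0 < M\<close> \<open>M < x\<close> by simp
    also have "\<dots> \<le> (\<integral>u. ?R u + g' x * (k (x - u) * indicator {M<..<x} u) \<partial>lborel)"
    proof (rule integral_mono_AE)
      show "AE u in lborel. ?L u \<le> ?R u + g' x * (k (x - u) * indicator {M<..<x} u)"
      proof (rule AE_lborel_finite[of "{M, x}"])
        fix u assume "u \<notin> {M, x}"
        then consider "u \<le> 0" | "0 < u" "u < M" | "M < u" "u < x" | "x < u" by force
        then show "?L u \<le> ?R u + g' x * (k (x - u) * indicator {M<..<x} u)"
        proof cases
          case 2
          then show ?thesis
            using pos[of u] k_antimono[of "M - u" "x - u"] \<open>M < x\<close> by simp
        next
          case 3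
          then have "1 \<le> k (x - u)"
            using k_antimono[of "x - u" \<xi>] k_xi e(2) x by simp
          then have "g' u * (k (x - u) - 1) \<le> g' x * (k (x - u) - 1)"
            using max[of u] 3 x by (intro mult_right_mono) auto
          also have "\<dots> \<le> g' x * k (x - u)"
            using gx by (intro mult_left_mono) auto
          finally show ?thesis
            using 3 \<open>0 < M\<close> by (simp add: k_zero algebra_simps)
        qed (use \<open>M < x\<close> \<open>0 < M\<close> in \<open>auto simp: g'_zero k_zero indicator_def\<close>)
      qed simp
    qed (intro Bochner_Integration.integrable_add Bochner_Integration.integrable_diff integrable_mult_right
        g'k_integrable g'_indicator_integrable k_shift_indicator_integrable)+
    also have "\<dots> = M * g' M + g' x * (\<integral>y. k y * indicator {0<..<x - M} y \<partial>lborel)"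
      using times_g'_eq[of M] \<open>0 < M\<close>
      by (simp add: k_window g'k_integrable g'_indicator_integrable)
    also have "\<dots> \<le> g' x * (\<integral>y. k y * indicator {0<..<e} y \<partial>lborel)"
      using x gx \<open>g' M = 0\<close> by (auto intro!: mult_left_mono k_window_mono)
    also have "\<dots> < g' x * M"
      using gx k_e by (rule mult_strict_left_mono[rotated])
    finally show False
      using \<open>M < x\<close> gx by (simp add: mult.commute)
  qed
  then show thesis
    using that[of e] e(1) max by fastforce
qed

text \<open>Let \<open>c\<close> be the infimum of the points beyond \<open>M\<close> with
  \<open>g' > 0\<close>. The initial window puts \<open>c\<close> strictly to the right of
  \<open>M\<close>, \<open>g'_neg_step\<close> gives \<open>g' c < 0\<close>, and continuity then
  excludes such points near \<open>c\<close>.\<close>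

lemma g'_neg_above:
  assumes M: "first_critical M" and "M < x"
  shows "g' x < 0"
proof (rule g'_neg_step[OF assms], rule ccontr)
  fix v assume v: "M < v" "v < x" "\<not> g' v \<le> 0"
  obtain e where e: "0 < e" "\<And>u. M \<le> u \<Longrightarrow> u \<le> M + e \<Longrightarrow> g' u \<le> 0"
    using g'_nonpos_right_of_critical[OF M] by blast
  define S where "S = {u. M \<le> u \<and> 0 < g' u}"
  define c where "c = Inf S"
  have "v \<in> S" using v by (simp add: S_def)
  have S_ge: "M + e \<le> u" if "u \<in> S" for u
    using e(2)[of u] that by (force simp: S_def)
  have bdd: "bdd_below S" using S_ge by (auto simp: bdd_below_def)
  have "M + e \<le> c"
    unfolding c_def using \<open>v \<in> S\<close> S_ge by (intro cInf_greatest) auto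
  then have "M < c" using e(1) by simp
  have below: "g' u \<le> 0" if "M < u" "u < c" for u
    using cInf_lower[OF _ bdd, of u] that by (force simp: S_def c_def)
  have "g' c < 0"
    using g'_neg_step[OF M \<open>M < c\<close> below] .
  have "0 \<le> g' c"
  proof (rule ccontr)
    assume "\<not> 0 \<le> g' c"
    have "open {u. g' u < 0}"
      using g'_cont by (intro open_Collect_less) auto
    then obtain d where d: "0 < d" "\<And>u. \<bar>u - c\<bar> < d \<Longrightarrow> g' u < 0"
      using \<open>g' c < 0\<close> by (force simp: open_dist dist_real_def)
    obtain u where u: "u \<in> S" "u < c + d"
      using cInf_lessD[of S "c + d"] \<open>v \<in> S\<close> d(1) unfolding c_def by auto
    have "c \<le> u"
      unfolding c_def using u(1) bdd by (rule cInf_lower)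
    then have "g' u < 0" using d u by auto
    with u(1) show False by (simp add: S_def)
  qed
  with \<open>g' c < 0\<close> show False by simp
qed

section \<open>Bounds on the mode: kernel mass and moments\<close>

text \<open>As \<open>g\<close> increases strictly up to \<open>M\<close>, replacing
  \<open>g u\<close> by \<open>g M\<close> in \<open>conv\<close> at \<open>M\<close> strictly
  enlarges the integral; dividing by \<open>g M > 0\<close> leaves the mass of \<open>k\<close>.
  Both upper bounds on the mode estimate this mass.\<close>

lemma first_critical_less_kernel_mass:
  assumes M: "first_critical M"
  shows "M < (\<integral>y. k y * indicator {0<..<M} y \<partial>lborel)"
proof -
  have pos: "0 < g' u" if "0 < u" "u < M" for u
    using M that by (auto simp: first_critical_def)
  have "0 < M" using M xi_pos by (auto simp: first_critical_def)
  have g_less: "g u < g M" if "0 < u" "u < M" for u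
  proof (rule DERIV_pos_imp_increasing_open[OF that(2)])
    show "\<exists>y. (g has_real_derivative y) (at v) \<and> 0 < y" if "u < v" "v < M" for v
      using g_deriv pos[of v] that \<open>0 < u\<close> by auto
    show "continuous_on {u..M} g"
      using g_cont by (rule continuous_on_subset) simp
  qed
  have "M * g M = (\<integral>u. g u * k (M - u) \<partial>lborel)" by (rule conv)
  also have "\<dots> < (\<integral>u. g M * (k (M - u) * indicator {0<..<M} u) \<partial>lborel)"
  proof (rule lborel_integral_strict_mono[where a=0 and b=M])
    have strict: "g u * k (M - u) < g M * (k (M - u) * indicator {0<..<M} u)" if "0 < u" "u < M" for u
      using that g_less[of u] k_pos[of "M - u"] by simp
    then show "0 < u \<Longrightarrow> u < M \<Longrightarrow> g u * k (M - u) < g M * (k (M - u) * indicator {0<..<M} u)" for u .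
    show "AE u in lborel. g u * k (M - u) \<le> g M * (k (M - u) * indicator {0<..<M} u)"
    proof (rule AE_I2)
      fix u
      consider "u \<le> 0" | "0 < u" "u < M" | "M \<le> u" by force
      then show "g u * k (M - u) \<le> g M * (k (M - u) * indicator {0<..<M} u)"
        by cases (use strict in \<open>auto simp: g_zero k_zero intro: less_imp_le\<close>)
    qed
  qed (use \<open>0 < M\<close> in \<open>auto intro: gk_integrable\<close>)
  also have "\<dots> = g M * (\<integral>y. k y * indicator {0<..<M} y \<partial>lborel)"
    by (simp add: k_window)
  finally show ?thesis
    using g_pos[OF \<open>0 < M\<close>] by (simp add: mult.commute)
qed

text \<open>Tonelli applied to \<open>conv\<close>, then the shift \<open>x = u + y\<close>.
  Nonnegative integrals make finiteness of the moments a result and not a prerequisite.\<close>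

lemma nn_integral_size_biased:
  assumes [measurable]: "w \<in> borel_measurable borel"
  shows "(\<integral>\<^sup>+x. w x * ennreal (x * g x) \<partial>lborel)
    = (\<integral>\<^sup>+u. \<integral>\<^sup>+y. w (u + y) * (ennreal (g u) * ennreal (k y)) \<partial>lborel \<partial>lborel)"
proof -
  have "(\<integral>\<^sup>+x. w x * ennreal (x * g x) \<partial>lborel)
      = (\<integral>\<^sup>+x. \<integral>\<^sup>+u. w x * (ennreal (g u) * ennreal (k (x - u))) \<partial>lborel \<partial>lborel)"
  proof (rule nn_integral_cong)
    fix x
    have "ennreal (x * g x) = (\<integral>\<^sup>+u. ennreal (g u * k (x - u)) \<partial>lborel)"
      unfolding conv
      by (rule nn_integral_eq_integral[symmetric]) (auto intro: gk_integrable simp: g_nonneg k_nonneg)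
    then show "w x * ennreal (x * g x) = (\<integral>\<^sup>+u. w x * (ennreal (g u) * ennreal (k (x - u))) \<partial>lborel)"
      by (simp add: nn_integral_cmult ennreal_mult g_nonneg k_nonneg)
  qed
  also have "\<dots> = (\<integral>\<^sup>+u. \<integral>\<^sup>+x. w x * (ennreal (g u) * ennreal (k (x - u))) \<partial>lborel \<partial>lborel)"
    by (rule lborel_pair.Fubini') measurable
  also have "\<dots> = (\<integral>\<^sup>+u. \<integral>\<^sup>+y. w (u + y) * (ennreal (g u) * ennreal (k y)) \<partial>lborel \<partial>lborel)"
  proof (rule nn_integral_cong)
    fix u
    show "(\<integral>\<^sup>+x. w x * (ennreal (g u) * ennreal (k (x - u))) \<partial>lborel)
        = (\<integral>\<^sup>+y. w (u + y) * (ennreal (g u) * ennreal (k y)) \<partial>lborel)"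
      by (subst nn_integral_real_affine[where c=1 and t=u]) simp_all
  qed
  finally show ?thesis .
qed

lemma first_moment:
  "has_bochner_integral lborel (\<lambda>x. x * g x) (integral\<^sup>L lborel k)"
proof (rule has_bochner_integral_nn_integral)
  show "AE x in lborel. 0 \<le> x * g x"
    by (rule AE_I2) (metis g_nonneg g_zero le_cases mult_eq_0_iff mult_nonneg_nonneg order_refl)
  have "(\<integral>\<^sup>+x. ennreal (x * g x) \<partial>lborel) = (\<integral>\<^sup>+u. ennreal (g u) * (\<integral>\<^sup>+y. ennreal (k y) \<partial>lborel) \<partial>lborel)"
    using nn_integral_size_biased[of "\<lambda>_. 1"] by (simp add: nn_integral_cmult)
  also have "\<dots> = (\<integral>\<^sup>+u. ennreal (g u) \<partial>lborel) * (\<integral>\<^sup>+y. ennreal (k y) \<partial>lborel)"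
    by (simp add: nn_integral_multc)
  also have "\<dots> = ennreal (integral\<^sup>L lborel k)"
    by (simp add: nn_integral_eq_integral g_integrable k_integrable g_nonneg k_nonneg g_integral)
  finally show "(\<integral>\<^sup>+x. ennreal (x * g x) \<partial>lborel) = ennreal (integral\<^sup>L lborel k)" .
qed (auto simp: k_nonneg)

text \<open>The size-biased formula with \<open>w x = x\<close>. As \<open>first_moment\<close>
  identifies \<open>integral\<^sup>L lborel k\<close> as the mean, the remaining term is the
  variance.\<close>

lemma second_moment:
  assumes yk: "integrable lborel (\<lambda>y. y * k y)"
  shows "has_bochner_integral lborel (\<lambda>x. x\<^sup>2 * g x)
    ((integral\<^sup>L lborel k)\<^sup>2 + (\<integral>y. y * k y \<partial>lborel))"
proof (rule has_bochner_integral_nn_integral)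
  have yk_nonneg: "0 \<le> y * k y" for y
    using k_zero[of y] k_nonneg[of y] by (cases "0 \<le> y") auto
  let ?m = "integral\<^sup>L lborel k" and ?c = "\<integral>y. y * k y \<partial>lborel"
  have m: "0 \<le> ?m" by (simp add: k_nonneg)
  have c: "0 \<le> ?c" by (simp add: yk_nonneg)
  have "(\<integral>\<^sup>+x. ennreal (x\<^sup>2 * g x) \<partial>lborel) = (\<integral>\<^sup>+x. ennreal x * ennreal (x * g x) \<partial>lborel)"
  proof (rule nn_integral_cong)
    fix x show "ennreal (x\<^sup>2 * g x) = ennreal x * ennreal (x * g x)"
      by (cases "0 \<le> x") (auto simp: g_zero g_nonneg power2_eq_square mult.assoc ennreal_mult')
  qed
  also have "\<dots> = (\<integral>\<^sup>+u. \<integral>\<^sup>+y. ennreal (u + y) * (ennreal (g u) * ennreal (k y)) \<partial>lborel \<partial>lborel)"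
    by (rule nn_integral_size_biased) simp
  also have "\<dots> = (\<integral>\<^sup>+u. ennreal ((u * g u) * ?m + g u * ?c) \<partial>lborel)"
  proof (rule nn_integral_cong)
    fix u
    have "(\<integral>\<^sup>+y. ennreal (u + y) * (ennreal (g u) * ennreal (k y)) \<partial>lborel)
        = (\<integral>\<^sup>+y. ennreal (u * g u * k y + g u * (y * k y)) \<partial>lborel)"
    proof (rule nn_integral_cong)
      fix y
      show "ennreal (u + y) * (ennreal (g u) * ennreal (k y)) = ennreal (u * g u * k y + g u * (y * k y))"
      proof (cases "0 < u \<and> 0 < y")
        case True
        then show ?thesis
          by (simp add: ennreal_mult[symmetric] g_nonneg k_nonneg distrib_left distrib_right mult_ac)
      next
        case False
        then have "g u = 0 \<or> k y = 0" using g_zero[of u] k_zero[of y] by force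
        then show ?thesis by auto
      qed
    qed
    also have "\<dots> = ennreal (\<integral>y. u * g u * k y + g u * (y * k y) \<partial>lborel)"
    proof (rule nn_integral_eq_integral)
      show "integrable lborel (\<lambda>y. u * g u * k y + g u * (y * k y))"
        by (intro Bochner_Integration.integrable_add integrable_mult_right k_integrable yk)
      have "0 \<le> u * g u"
        using g_zero[of u] g_nonneg[of u] by (cases "0 \<le> u") auto
      then show "AE y in lborel. 0 \<le> u * g u * k y + g u * (y * k y)"
        by (intro AE_I2 add_nonneg_nonneg mult_nonneg_nonneg[of "u * g u"] mult_nonneg_nonneg[of "g u"])
          (auto simp: g_nonneg k_nonneg yk_nonneg)
    qed
    also have "\<dots> = ennreal ((u * g u) * ?m + g u * ?c)"
      by (simp add: k_integrable yk)
    finally show "(\<integral>\<^sup>+y. ennreal (u + y) * (ennreal (g u) * ennreal (k y)) \<partial>lborel)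
        = ennreal ((u * g u) * ?m + g u * ?c)" .
  qed
  also have "\<dots> = ennreal (\<integral>u. (u * g u) * ?m + g u * ?c \<partial>lborel)"
  proof (rule nn_integral_eq_integral)
    show "integrable lborel (\<lambda>u. (u * g u) * ?m + g u * ?c)"
      using first_moment g_integrable
      by (intro Bochner_Integration.integrable_add integrable_mult_left) (auto simp: has_bochner_integral_iff)
    have "0 \<le> u * g u" for u
      using g_zero[of u] g_nonneg[of u] by (cases "0 \<le> u") auto
    then show "AE u in lborel. 0 \<le> (u * g u) * ?m + g u * ?c"
      using m c g_nonneg by (intro AE_I2 add_nonneg_nonneg mult_nonneg_nonneg[of _ ?m] mult_nonneg_nonneg[of _ ?c])
  qed
  also have "(\<integral>u. (u * g u) * ?m + g u * ?c \<partial>lborel) = ?m\<^sup>2 + ?c"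
    using first_moment g_integrable g_integral by (simp add: has_bochner_integral_iff power2_eq_square)
  finally show "(\<integral>\<^sup>+x. ennreal (x\<^sup>2 * g x) \<partial>lborel) = ennreal (?m\<^sup>2 + ?c)" .
  show "0 \<le> ?m\<^sup>2 + ?c" using c by simp
qed (auto simp: g_nonneg)

text \<open>Khintchine's observation that \<open>(M - x) * g' x\<close> is a density when \<open>M\<close> is the mode: integrating it
  against the square of an affine function and minimising over the affine function bounds the distance
  of mode and mean by \<open>sqrt 3\<close> standard deviations (Johnson and Rogers).\<close>

lemma mode_mean_distance:
  assumes M: "first_critical M" and yk: "integrable lborel (\<lambda>y. y * k y)"
  shows "(integral\<^sup>L lborel k - M)\<^sup>2 < 3 * (\<integral>y. y * k y \<partial>lborel)"
proof -
  have pos: "0 < g' u" if "0 < u" "u < M" for u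
    using M that by (auto simp: first_critical_def)
  have "g' M = 0" "0 < M" using M xi_pos by (auto simp: first_critical_def)
  define m where "m = integral\<^sup>L lborel k"
  \<comment> \<open>With \<open>d = m - M\<close> and variance \<open>v\<close>, the integral of
    \<open>p x * g x\<close> is \<open>3 * v + 3 * d\<^sup>2 - 4 * t * d + t\<^sup>2\<close>; the
    choice \<open>t = 2 * d\<close> minimises it, with value
    \<open>3 * v - d\<^sup>2\<close>.\<close>
  define t where "t = 2 * (m - M)"
  \<comment> \<open>\<open>p\<close> is the derivative of
    \<open>(x - M) * (x - M - t)\<^sup>2\<close>, so this cubic times \<open>g\<close> has
    derivative \<open>p x * g x - q x\<close>.\<close>
  define p where "p x = (x - M - t)\<^sup>2 + 2 * (x - M) * (x - M - t)" for x
  define q where "q x = (M - x) * g' x * (x - M - t)\<^sup>2" for x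
  define c where "c = (\<integral>x. q x * indicator {0..M} x \<partial>lborel)"
  have q_cont: "continuous_on UNIV q" unfolding q_def using g'_cont by (intro continuous_intros)
  have pg_cont: "continuous_on UNIV (\<lambda>x. p x * g x)"
    unfolding p_def using g_cont by (intro continuous_intros)
  have q_nonneg: "0 \<le> q x" if "0 < x" for x
  proof (cases x M rule: linorder_cases)
    case less
    then show ?thesis using pos[of x] that by (simp add: q_def)
  next
    case greater
    then have "0 \<le> (M - x) * g' x"
      using g'_neg_above[OF M greater] by (intro mult_nonpos_nonpos) auto
    then show ?thesis by (simp add: q_def)
  qed (simp add: q_def)
  have "0 < c"
    unfolding c_def
  proof (rule lborel_integral_pos)
    \<comment> \<open>Selects a half of the interval from 0 to \<open>M\<close> that avoids the zero
      \<open>M + t\<close> of the square.\<close>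
    define a where "a = (if M + t \<le> M / 2 then M / 2 else 0)"
    show "a < a + M / 2" using \<open>0 < M\<close> by simp
    show "0 < q x * indicator {0..M} x" if "a < x" "x < a + M / 2" for x
    proof -
      have "0 < x" "x < M" "x - M - t \<noteq> 0"
        using that \<open>0 < M\<close> by (auto simp: a_def split: if_splits)
      then show ?thesis using pos[of x] by (simp add: q_def)
    qed
    show "AE x in lborel. 0 \<le> q x * indicator {0..M} x"
    proof (rule AE_I2)
      fix x show "0 \<le> q x * indicator {0..M} x"
        using q_nonneg[of x] g'_zero[of x] by (cases "0 < x") (auto simp: q_def indicator_def)
    qed
  qed (rule integrable_continuous_mult_indicator[OF q_cont])
  have gint: "integrable lborel (\<lambda>x. x * g x)" "(\<integral>x. x * g x \<partial>lborel) = m"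
    and g2int: "integrable lborel (\<lambda>x. x\<^sup>2 * g x)"
      "(\<integral>x. x\<^sup>2 * g x \<partial>lborel) = m\<^sup>2 + (\<integral>y. y * k y \<partial>lborel)"
    using first_moment second_moment[OF yk] by (auto simp: has_bochner_integral_iff m_def)
  have pg: "p x * g x = 3 * (x\<^sup>2 * g x) - (6 * M + 4 * t) * (x * g x) + (3 * M\<^sup>2 + 4 * t * M + t\<^sup>2) * g x" for x
    by (simp add: p_def power2_eq_square algebra_simps)
  have pg_int: "integrable lborel (\<lambda>x. p x * g x)"
    unfolding pg using gint g2int g_integrable by simp
  have ge: "c \<le> (\<integral>x. (p x * g x) * indicator {0..M + real n} x \<partial>lborel)" for n
  proof -
    let ?N = "M + real n"
    have "(\<integral>x. (p x * g x - q x) * indicator {0..?N} x \<partial>lborel)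
        = (?N - M) * (?N - M - t)\<^sup>2 * g ?N - (0 - M) * (0 - M - t)\<^sup>2 * g 0"
    proof (rule integral_FTC_Icc_real)
      show "((\<lambda>x. (x - M) * (x - M - t)\<^sup>2 * g x) has_real_derivative p x * g x - q x) (at x)" for x
        by (auto intro!: derivative_eq_intros g_deriv simp: p_def q_def power2_eq_square algebra_simps)
      show "isCont (\<lambda>x. p x * g x - q x) x" for x
        using q_cont pg_cont by (simp add: continuous_on_eq_continuous_at)
    qed (use \<open>0 < M\<close> in simp)
    \<comment> \<open>The upper boundary term is discarded by its sign, so no tail estimate for
      \<open>g\<close> enters.\<close>
    also have "\<dots> \<ge> 0" by (simp add: g_zero g_nonneg)
    finally have "0 \<le> (\<integral>x. (p x * g x) * indicator {0..?N} x \<partial>lborel) - (\<integral>x. q x * indicator {0..?N} x \<partial>lborel)"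
      using integrable_continuous_mult_indicator[OF q_cont] integrable_continuous_mult_indicator[OF pg_cont]
      by (simp add: left_diff_distrib)
    moreover have "c \<le> (\<integral>x. q x * indicator {0..?N} x \<partial>lborel)"
      unfolding c_def
    proof (rule integral_mono)
      fix x show "q x * indicator {0..M} x \<le> q x * indicator {0..?N} x"
        using q_nonneg[of x] \<open>0 < M\<close> by (auto simp: indicator_def)
    qed (rule integrable_continuous_mult_indicator[OF q_cont])+
    ultimately show ?thesis by simp
  qed
  have "(\<lambda>n. \<integral>x. (p x * g x) * indicator {0..M + real n} x \<partial>lborel) \<longlonglongrightarrow> (\<integral>x. p x * g x \<partial>lborel)"
  proof (rule integral_dominated_convergence[where w="\<lambda>x. norm (p x * g x)"])
    show "AE x in lborel. (\<lambda>n. (p x * g x) * indicator {0..M + real n} x) \<longlonglongrightarrow> p x * g x"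
    proof (rule AE_I2)
      fix x
      obtain N where N: "x \<le> real N" using real_arch_simple by blast
      have "(p x * g x) * indicator {0..M + real n} x = p x * g x" if "N \<le> n" for n
        using that N \<open>0 < M\<close> g_zero[of x] by (auto simp: indicator_def)
      then show "(\<lambda>n. (p x * g x) * indicator {0..M + real n} x) \<longlonglongrightarrow> p x * g x"
        by (intro tendsto_eventually) (auto simp: eventually_sequentially)
    qed
    show "integrable lborel (\<lambda>x. norm (p x * g x))" using pg_int by (rule integrable_norm)
  qed (use pg_int in \<open>auto simp: indicator_def\<close>)
  then have "c \<le> (\<integral>x. p x * g x \<partial>lborel)"
    using ge by (intro LIMSEQ_le_const) auto
  with \<open>0 < c\<close> have "0 < (\<integral>x. p x * g x \<partial>lborel)" by simp
  also have "\<dots> = 3 * (m\<^sup>2 + (\<integral>y. y * k y \<partial>lborel)) - (6 * M + 4 * t) * m + (3 * M\<^sup>2 + 4 * t * M + t\<^sup>2)"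
    unfolding pg using gint g2int g_integrable g_integral by simp
  also have "\<dots> = 3 * (\<integral>y. y * k y \<partial>lborel) - (m - M)\<^sup>2"
    by (simp add: t_def power2_eq_square algebra_simps)
  finally show ?thesis by (simp add: m_def)
qed

end

section \<open>Fourier inversion for integrable characteristic functions\<close>

lemma has_vector_derivative_iff_quotient:
  fixes f :: "real \<Rightarrow> 'a::real_normed_vector"
  shows "(f has_vector_derivative D) (at x) \<longleftrightarrow>
    ((\<lambda>y. (f y - f x - (y - x) *\<^sub>R D) /\<^sub>R \<bar>y - x\<bar>) \<longlongrightarrow> 0) (at x)"
  unfolding has_vector_derivative_def has_derivative_at_within
  by (simp add: bounded_linear_scaleR_left divide_inverse_commute)

text \<open>By the mean value inequality the bound on \<open>f'\<close> controls the linear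
  remainder by \<open>2 * w y\<close> times the increment; dominated convergence along sequences
  then sends the integrated remainder quotient to 0.\<close>

lemma has_vector_derivative_integral:
  fixes f f' :: "real \<Rightarrow> 'a \<Rightarrow> 'b::{banach, second_countable_topology}"
  assumes int: "\<And>x. integrable M (f x)"
    and deriv: "\<And>x y. y \<in> space M \<Longrightarrow> ((\<lambda>x. f x y) has_vector_derivative f' x y) (at x)"
    and meas: "\<And>x. f' x \<in> borel_measurable M"
    and bound: "\<And>x y. y \<in> space M \<Longrightarrow> norm (f' x y) \<le> w y"
    and w: "integrable M w"
  shows "((\<lambda>x. \<integral>y. f x y \<partial>M) has_vector_derivative (\<integral>y. f' x y \<partial>M)) (at x)"
  unfolding has_vector_derivative_iff_quotient tendsto_at_iff_sequentially
proof (intro allI impI)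
  fix X :: "nat \<Rightarrow> real"
  assume X: "\<forall>i. X i \<in> UNIV - {x}" "X \<longlonglongrightarrow> x"
  have int': "integrable M (f' x)" for x
    by (rule Bochner_Integration.integrable_bound[OF w meas])
      (use bound in \<open>auto intro!: AE_I2 intro: order_trans[OF _ abs_ge_self]\<close>)
  let ?q = "\<lambda>n y. (f (X n) y - f x y - (X n - x) *\<^sub>R f' x y) /\<^sub>R \<bar>X n - x\<bar>"
  have "(\<lambda>n. \<integral>y. ?q n y \<partial>M) \<longlonglongrightarrow> (\<integral>y. 0 \<partial>M)"
  proof (rule integral_dominated_convergence[where w="\<lambda>y. 2 * w y"])
    show "integrable M (\<lambda>y. 2 * w y)" using w by simp
    show "?q n \<in> borel_measurable M" for n
      using int int' by (intro borel_measurable_scaleR borel_measurable_diff) auto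
    show "AE y in M. (\<lambda>n. ?q n y) \<longlonglongrightarrow> 0"
    proof (rule AE_I2)
      fix y assume "y \<in> space M"
      from deriv[OF this, of x] show "(\<lambda>n. ?q n y) \<longlonglongrightarrow> 0"
        unfolding has_vector_derivative_iff_quotient tendsto_at_iff_sequentially o_def
        using X by blast
    qed
    show "AE y in M. norm (?q n y) \<le> 2 * w y" for n
    proof (rule AE_I2)
      fix y assume y: "y \<in> space M"
      have "norm (f (X n) y - f x y - (X n - x) *\<^sub>R f' x y) \<le> norm (X n - x) * (2 * w y)"
      proof (rule vector_differentiable_bound_linearization[where S=UNIV])
        show "norm (f' z y - f' x y) \<le> 2 * w y" for z
          using norm_triangle_ineq4[of "f' z y" "f' x y"] bound[OF y, of z] bound[OF y, of x] by linarith
      qed (use deriv[OF y] in auto)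
      then have "norm (?q n y) \<le> inverse \<bar>X n - x\<bar> * (\<bar>X n - x\<bar> * (2 * w y))"
        by (simp add: mult_left_mono)
      also have "\<dots> = 2 * w y"
        using X(1) by auto
      finally show "norm (?q n y) \<le> 2 * w y" .
    qed
  qed simp
  moreover have eq: "(\<integral>y. ?q n y \<partial>M) = (integral\<^sup>L M (f (X n)) - integral\<^sup>L M (f x)
      - (X n - x) *\<^sub>R integral\<^sup>L M (f' x)) /\<^sub>R \<bar>X n - x\<bar>" for n
    using int int' by simp
  ultimately show "((\<lambda>y. (integral\<^sup>L M (f y) - integral\<^sup>L M (f x)
      - (y - x) *\<^sub>R integral\<^sup>L M (f' x)) /\<^sub>R \<bar>y - x\<bar>) \<circ> X) \<longlonglongrightarrow> 0"
    unfolding o_def eq by (simp only: integral_zero)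
qed

lemma continuous_on_integral_dominated:
  fixes f :: "real \<Rightarrow> 'a \<Rightarrow> 'b::{banach, second_countable_topology}"
  assumes "\<And>x. f x \<in> borel_measurable M"
    and "\<And>y. y \<in> space M \<Longrightarrow> continuous_on UNIV (\<lambda>x. f x y)"
    and "\<And>x y. y \<in> space M \<Longrightarrow> norm (f x y) \<le> w y" and "integrable M w"
  shows "continuous_on UNIV (\<lambda>x. \<integral>y. f x y \<partial>M)"
proof (rule continuous_on_sequentiallyI)
  fix u :: "nat \<Rightarrow> real" and a assume "u \<longlonglongrightarrow> a"
  then show "(\<lambda>n. \<integral>y. f (u n) y \<partial>M) \<longlonglongrightarrow> (\<integral>y. f a y \<partial>M)"
    using assms
    by (intro integral_dominated_convergence[where w=w] AE_I2)
      (auto intro: continuous_on_tendsto_compose[where s=UNIV])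
qed

lemma (in pair_sigma_finite) integrable_pair_mult:
  fixes f :: "'a \<Rightarrow> real" and h :: "'b \<Rightarrow> real"
  assumes [measurable]: "integrable M1 f" "integrable M2 h"
  shows "integrable (M1 \<Otimes>\<^sub>M M2) (\<lambda>(x, y). f x * h y)"
  using assms by (intro Fubini_integrable) (auto simp: abs_mult)

section \<open>The Fourier transform of an integrable function\<close>

text \<open>Opposite sign to \<open>char\<close> and no normalising factor, so inversion carries
  \<open>1 / (2 * pi)\<close>.\<close>

definition fourier :: "(real \<Rightarrow> complex) \<Rightarrow> real \<Rightarrow> complex" where
  "fourier \<phi> x = (\<integral>t. iexp (- (t * x)) * \<phi> t \<partial>lborel)"

lemma norm_exp_minus_i_times [simp]: "cmod (exp (- (\<i> * (complex_of_real a * complex_of_real b)))) = 1"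
  by (simp add: norm_exp_eq_Re)

lemma norm_iexp_minus_mult [simp]:
  "cmod (exp (- (\<i> * (complex_of_real a * complex_of_real b))) * z) = cmod z"
  by (simp add: norm_mult)

lemma iexp_measurable [measurable]: "iexp \<in> borel_measurable borel"
  by (intro borel_measurable_continuous_onI continuous_intros)

lemma fourier_integrable:
  assumes \<phi>: "integrable lborel \<phi>"
  shows "integrable lborel (\<lambda>t. iexp (- (t * x)) * \<phi> t)"
proof (rule Bochner_Integration.integrable_bound[OF \<phi>])
  show "(\<lambda>t. iexp (- (t * x)) * \<phi> t) \<in> borel_measurable lborel"
    using borel_measurable_integrable[OF \<phi>] by measurable
qed simp

lemma continuous_on_fourier:
  assumes \<phi>: "integrable lborel \<phi>"
  shows "continuous_on UNIV (fourier \<phi>)"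
  unfolding fourier_def
proof (rule continuous_on_integral_dominated[where w="\<lambda>t. cmod (\<phi> t)"])
  show "(\<lambda>t. iexp (- (t * x)) * \<phi> t) \<in> borel_measurable lborel" for x
    using fourier_integrable[OF \<phi>] by auto
qed (use \<phi> in \<open>auto intro!: continuous_intros\<close>)

lemma norm_fourier_le: "cmod (fourier \<phi> x) \<le> (\<integral>t. cmod (\<phi> t) \<partial>lborel)"
  unfolding fourier_def using integral_norm_bound[of lborel "\<lambda>t. iexp (- (t * x)) * \<phi> t"] by simp

lemma fourier_has_vector_derivative:
  fixes \<phi> :: "real \<Rightarrow> complex"
  assumes \<phi>: "integrable lborel \<phi>" and t\<phi>: "integrable lborel (\<lambda>t. - \<i> * t * \<phi> t)"
  shows "(fourier \<phi> has_vector_derivative fourier (\<lambda>t. - \<i> * t * \<phi> t) x) (at x)"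
  unfolding fourier_def
proof (rule has_vector_derivative_integral[where w="\<lambda>t. cmod (- \<i> * t * \<phi> t)"])
  show "((\<lambda>x. iexp (- (t * x)) * \<phi> t) has_vector_derivative iexp (- (t * x)) * (- \<i> * t * \<phi> t)) (at x)" for x t
  proof -
    have "((\<lambda>x. exp (- (\<i> * t * complex_of_real x))) has_vector_derivative exp (- (\<i> * t * x)) * (- \<i> * t)) (at x)"
      by (rule has_vector_derivative_real_field) (auto intro!: derivative_eq_intros)
    then have "((\<lambda>x. exp (- (\<i> * t * complex_of_real x)) * \<phi> t) has_vector_derivative exp (- (\<i> * t * x)) * (- \<i> * t) * \<phi> t) (at x)"
      by (rule has_vector_derivative_mult_left)
    then show ?thesis by (simp add: mult_ac)
  qed
  show "(\<lambda>t. iexp (- (t * x)) * (- \<i> * t * \<phi> t)) \<in> borel_measurable lborel" for x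
    using fourier_integrable[OF t\<phi>] by auto
  show "integrable lborel (\<lambda>t. cmod (- \<i> * t * \<phi> t))" using t\<phi> by (rule integrable_norm)
qed (use fourier_integrable[OF \<phi>] in auto)

lemma fourier_cmult: "fourier (\<lambda>t. c * f t) x = c * fourier f x"
  unfolding fourier_def by (subst integral_mult_right_zero[symmetric]) (simp add: mult_ac)

lemma fourier_add:
  assumes "integrable lborel \<phi>" "integrable lborel \<psi>"
  shows "fourier (\<lambda>t. \<phi> t + \<psi> t) x = fourier \<phi> x + fourier \<psi> x"
  unfolding fourier_def using fourier_integrable[OF assms(1)] fourier_integrable[OF assms(2)]
  by (simp only: distrib_left Bochner_Integration.integral_add)

text \<open>Fubini, dominated by the product of \<open>cmod (\<phi> t)\<close> and
  \<open>h y\<close>. The map \<open>a\<close> covers two uses: the identity for inversion on an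
  interval, and \<open>\<lambda>y. x - y\<close> for the convolution theorem.\<close>

lemma integral_fourier_mult:
  assumes \<phi>: "integrable lborel \<phi>" and h: "integrable lborel (h :: real \<Rightarrow> real)"
    and a[measurable]: "a \<in> borel_measurable borel"
  shows "(\<integral>y. fourier \<phi> (a y) * h y \<partial>lborel) = (\<integral>t. (\<integral>y. iexp (- (t * a y)) * h y \<partial>lborel) * \<phi> t \<partial>lborel)"
    and "integrable lborel (\<lambda>y. fourier \<phi> (a y) * h y)"
proof -
  have [measurable]: "\<phi> \<in> borel_measurable borel" "h \<in> borel_measurable borel"
    using \<phi> h by auto
  have "integrable (lborel \<Otimes>\<^sub>M lborel) (\<lambda>(t, y). cmod (\<phi> t) * h y)"
    using \<phi> h by (intro lborel_pair.integrable_pair_mult) auto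
  then have int: "integrable (lborel \<Otimes>\<^sub>M lborel) (\<lambda>(t, y). iexp (- (t * a y)) * \<phi> t * h y)"
    by (rule Bochner_Integration.integrable_bound) (auto simp: norm_mult)
  have "(\<integral>y. fourier \<phi> (a y) * h y \<partial>lborel) = (\<integral>y. (\<integral>t. iexp (- (t * a y)) * \<phi> t * h y \<partial>lborel) \<partial>lborel)"
    by (simp add: fourier_def)
  also have "\<dots> = (\<integral>t. (\<integral>y. iexp (- (t * a y)) * \<phi> t * h y \<partial>lborel) \<partial>lborel)"
    using int by (rule lborel_pair.Fubini_integral)
  also have "\<dots> = (\<integral>t. (\<integral>y. iexp (- (t * a y)) * h y \<partial>lborel) * \<phi> t \<partial>lborel)"
    by (simp flip: integral_mult_left_zero add: mult_ac)
  finally show "(\<integral>y. fourier \<phi> (a y) * h y \<partial>lborel) = (\<integral>t. (\<integral>y. iexp (- (t * a y)) * h y \<partial>lborel) * \<phi> t \<partial>lborel)" .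
  show "integrable lborel (\<lambda>y. fourier \<phi> (a y) * h y)"
    using lborel_pair.integrable_snd[OF int] by (simp add: fourier_def)
qed

section \<open>Inversion: an integrable characteristic function gives a density\<close>

context real_distribution
begin

context
  assumes char_int: "integrable lborel (char M)"
begin

text \<open>Integrability of \<open>char M\<close> removes the truncation in Levy's inversion
  formula. The quotient \<open>?F t\<close> is the transform of the indicator of
  \<open>{a..b}\<close>, so Fubini moves the transform onto \<open>char M\<close>. Levy's formula
  excludes atoms at the endpoints; \<open>measure_singleton_eq_0\<close> lifts this
  restriction.\<close>

lemma measure_Ioc_eq_fourier_continuity_points:
  assumes "a \<le> b" "measure M {a} = 0" "measure M {b} = 0"
  shows "measure M {a<..b} = (\<integral>x. Re (fourier (char M) x) / (2 * pi) * indicator {a..b} x \<partial>lborel)"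
proof -
  let ?F = "\<lambda>t. (iexp (- (t * a)) - iexp (- (t * b))) / (\<i> * t)"
  have [measurable]: "char M \<in> borel_measurable borel" using char_int by auto
  have F_bound: "cmod (?F t) \<le> b - a" for t
    using Levy_Inversion_aux2[of "-b" "-a" t] assms(1) by (cases "t = 0") (auto simp: norm_minus_commute)
  have bound: "cmod (?F t * char M t) \<le> (b - a) * cmod (char M t)" for t
    unfolding norm_mult using F_bound[of t] by (rule mult_right_mono) simp
  have w: "integrable lborel (\<lambda>t. (b - a) * cmod (char M t))"
    using char_int by (intro integrable_mult_right integrable_norm)
  have "(\<lambda>T. CLBINT t. indicator {- real T<..<real T} t *\<^sub>R (?F t * char M t)) \<longlonglongrightarrow> (CLBINT t. ?F t * char M t)"
  proof (rule integral_dominated_convergence[OF _ _ w])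
    show "AE t in lborel. (\<lambda>T. indicator {- real T<..<real T} t *\<^sub>R (?F t * char M t)) \<longlonglongrightarrow> ?F t * char M t"
    proof (rule AE_I2)
      fix t :: real
      obtain N where "\<bar>t\<bar> < real N" using reals_Archimedean2 by blast
      then have "indicator {- real T<..<real T} t *\<^sub>R (?F t * char M t) = ?F t * char M t" if "N \<le> T" for T
        using that by (auto simp: indicator_def)
      then show "(\<lambda>T. indicator {- real T<..<real T} t *\<^sub>R (?F t * char M t)) \<longlonglongrightarrow> ?F t * char M t"
        by (intro tendsto_eventually) (auto simp: eventually_sequentially)
    qed
    show "AE t in lborel. cmod (indicator {- real T<..<real T} t *\<^sub>R (?F t * char M t)) \<le> (b - a) * cmod (char M t)" for T
      using bound assms(1) by (intro AE_I2) (auto simp: indicator_def simp del: norm_mult)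
  qed measurable
  then have "(\<lambda>T. 1 / (2 * pi) * (CLBINT t=-T..T. ?F t * char M t)) \<longlonglongrightarrow> 1 / (2 * pi) * (CLBINT t. ?F t * char M t)"
    by (intro tendsto_mult tendsto_const)
      (simp add: interval_lebesgue_integral_def set_lebesgue_integral_def)
  with Levy_Inversion[OF assms] have eq: "complex_of_real (measure M {a<..b}) = 1 / (2 * pi) * (CLBINT t. ?F t * char M t)"
    using LIMSEQ_unique by blast
  have "(CLBINT t. ?F t * char M t) = (\<integral>t. (\<integral>x. iexp (- (t * x)) * of_real (indicator {a..b} x) \<partial>lborel) * char M t \<partial>lborel)"
  proof (rule integral_cong_AE)
    \<comment> \<open>Only almost everywhere: at \<open>t = 0\<close> division by zero makes
      \<open>?F 0 = 0\<close> instead of \<open>b - a\<close>.\<close>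
    show "AE t in lborel. ?F t * char M t = (\<integral>x. iexp (- (t * x)) * of_real (indicator {a..b} x) \<partial>lborel) * char M t"
      using AE_lborel_singleton[of 0]
    proof eventually_elim
      fix t :: real assume "t \<noteq> 0"
      have "(\<integral>x. iexp (- (t * x)) * of_real (indicator {a..b} x) \<partial>lborel)
          = (\<integral>x. indicator {a..b} x *\<^sub>R iexp (- (t * x)) \<partial>lborel)"
        by (intro Bochner_Integration.integral_cong) (auto simp: indicator_def)
      also have "\<dots> = \<i> / t * iexp (- (t * b)) - \<i> / t * iexp (- (t * a))"
      proof (rule integral_FTC_Icc[OF assms(1)])
        show "((\<lambda>x. \<i> / t * iexp (- (t * x))) has_vector_derivative iexp (- (t * x))) (at x within {a..b})" for x
        proof -
          have "((\<lambda>x. \<i> / t * exp (\<i> * (- (t * complex_of_real x)))) has_vector_derivative iexp (- (t * x))) (at x within {a..b})"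
            using \<open>t \<noteq> 0\<close> by (intro has_vector_derivative_real_field) (auto intro!: derivative_eq_intros)
          then show ?thesis by simp
        qed
      qed (intro continuous_intros)
      also have "\<dots> = ?F t"
        using \<open>t \<noteq> 0\<close> by (simp add: field_simps)
      finally show "?F t * char M t = (\<integral>x. iexp (- (t * x)) * of_real (indicator {a..b} x) \<partial>lborel) * char M t"
        by simp
    qed
  qed measurable
  also have "\<dots> = (\<integral>x. fourier (char M) x * of_real (indicator {a..b} x) \<partial>lborel)"
    by (rule integral_fourier_mult(1)[symmetric, OF char_int])
      (auto simp: emeasure_lborel_Icc_eq intro: integrable_real_indicator)
  finally have eq': "complex_of_real (measure M {a<..b}) = 1 / (2 * pi) * (\<integral>x. fourier (char M) x * of_real (indicator {a..b} x) \<partial>lborel)"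
    using eq by simp
  have int: "integrable lborel (\<lambda>x. fourier (char M) x * complex_of_real (indicator {a..b} x))"
    by (rule integral_fourier_mult(2)[OF char_int])
      (auto simp: emeasure_lborel_Icc_eq intro: integrable_real_indicator)
  have "measure M {a<..b} = Re (\<integral>x. fourier (char M) x * of_real (indicator {a..b} x) \<partial>lborel) / (2 * pi)"
    using arg_cong[OF eq', of Re] by (simp add: Re_divide_of_real flip: of_real_mult)
  also have "\<dots> = (\<integral>x. Re (fourier (char M) x * of_real (indicator {a..b} x)) / (2 * pi) \<partial>lborel)"
    using integral_Re[OF int] by simp
  finally show ?thesis
    by simp
qed

text \<open>Atoms are countable, so there are atom-free points \<open>a < x < b\<close> arbitrarily
  close to \<open>x\<close>. The candidate density is bounded by \<open>B\<close>, whence the mass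
  of \<open>{x}\<close> is at most \<open>B * (b - a)\<close>.\<close>

lemma measure_singleton_eq_0: "measure M {x} = 0"
proof -
  define B where "B = (\<integral>t. cmod (char M t) \<partial>lborel) / (2 * pi)"
  have "0 \<le> B" by (simp add: B_def)
  have B: "Re (fourier (char M) x) / (2 * pi) \<le> B" for x
    unfolding B_def using norm_fourier_le[of "char M" x] abs_Re_le_cmod[of "fourier (char M) x"]
    by (intro divide_right_mono) auto
  have "measure M {x} \<le> 0 + e" if "0 < e" for e
  proof -
    \<comment> \<open>\<open>B + 1\<close> guards against \<open>B = 0\<close>.\<close>
    define d where "d = e / (2 * (B + 1))"
    have "0 < d" using that \<open>0 \<le> B\<close> by (simp add: d_def)
    obtain a where a: "a \<in> {x - d<..<x}" "measure M {a} = 0"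
      using open_minus_countable[OF countable_support, of "{x - d<..<x}"] \<open>0 < d\<close> by auto
    obtain b where b: "b \<in> {x<..<x + d}" "measure M {b} = 0"
      using open_minus_countable[OF countable_support, of "{x<..<x + d}"] \<open>0 < d\<close> by auto
    have "measure M {x} \<le> measure M {a<..b}"
      using a b by (intro finite_measure_mono) auto
    also have "\<dots> = (\<integral>x. Re (fourier (char M) x) / (2 * pi) * indicator {a..b} x \<partial>lborel)"
      using a b by (intro measure_Ioc_eq_fourier_continuity_points) auto
    also have "\<dots> \<le> (\<integral>x. B * indicator {a..b} x \<partial>lborel)"
    proof (rule integral_mono)
      show "integrable lborel (\<lambda>x. Re (fourier (char M) x) / (2 * pi) * indicator {a..b} x)"
        using continuous_on_fourier[OF char_int]
        by (intro integrable_continuous_mult_indicator continuous_intros) auto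
      show "integrable lborel (\<lambda>x. B * indicator {a..b} x)"
        by (intro integrable_mult_right integrable_real_indicator) (auto simp: emeasure_lborel_Icc_eq)
    qed (use B \<open>0 \<le> B\<close> in \<open>auto simp: indicator_def\<close>)
    also have "\<dots> = B * (b - a)" using a b by simp
    also have "\<dots> \<le> (B + 1) * (2 * d)" using a b \<open>0 \<le> B\<close> by (intro mult_mono) auto
    also have "\<dots> = e" using \<open>0 \<le> B\<close> by (simp add: d_def field_simps)
    finally show ?thesis by simp
  qed
  then have "measure M {x} \<le> 0" by (rule field_le_epsilon)
  then show ?thesis by (simp add: measure_le_0_iff)
qed

lemma measure_Ioc_eq_fourier:
  assumes "a \<le> b"
  shows "measure M {a<..b} = (\<integral>x. Re (fourier (char M) x) / (2 * pi) * indicator {a..b} x \<partial>lborel)"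
  using assms measure_singleton_eq_0 by (intro measure_Ioc_eq_fourier_continuity_points) auto

text \<open>A negative value would persist on an interval by continuity, and that interval would
  have negative measure.\<close>

lemma Re_fourier_char_nonneg: "0 \<le> Re (fourier (char M) x)"
proof (rule ccontr)
  assume neg: "\<not> 0 \<le> Re (fourier (char M) x)"
  have cont: "continuous_on UNIV (\<lambda>x. Re (fourier (char M) x))"
    using continuous_on_fourier[OF char_int] by (intro continuous_intros)
  then have "open {y. Re (fourier (char M) y) < 0}"
    by (intro open_Collect_less continuous_on_const)
  then obtain e where e: "0 < e" "ball x e \<subseteq> {y. Re (fourier (char M) y) < 0}"
    using neg unfolding open_contains_ball by (metis mem_Collect_eq not_le)
  define d where "d = e / 2"
  have below: "Re (fourier (char M) y) < 0" if "y \<in> {x - d..x + d}" for y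
  proof -
    have "\<bar>x - y\<bar> < e" using that e(1) by (auto simp: d_def abs_less_iff)
    then have "y \<in> ball x e" by (simp add: dist_real_def)
    with e(2) show ?thesis by blast
  qed
  have "0 < (\<integral>y. - (Re (fourier (char M) y) / (2 * pi) * indicator {x - d..x + d} y) \<partial>lborel)"
  proof (rule lborel_integral_pos)
    show "integrable lborel (\<lambda>y. - (Re (fourier (char M) y) / (2 * pi) * indicator {x - d..x + d} y))"
      using cont by (intro Bochner_Integration.integrable_minus integrable_continuous_mult_indicator
          continuous_on_divide continuous_on_const) auto
    show "AE y in lborel. 0 \<le> - (Re (fourier (char M) y) / (2 * pi) * indicator {x - d..x + d} y)"
    proof (rule AE_I2)
      fix y show "0 \<le> - (Re (fourier (char M) y) / (2 * pi) * indicator {x - d..x + d} y)"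
        using below[of y] by (cases "y \<in> {x - d..x + d}") (auto simp: divide_nonpos_pos)
    qed
    show "0 < - (Re (fourier (char M) y) / (2 * pi) * indicator {x - d..x + d} y)"
      if "x - d < y" "y < x + d" for y
      using below[of y] that by (auto simp: divide_neg_pos)
  qed (use e(1) in \<open>simp add: d_def\<close>)
  also have "\<dots> = - measure M {x - d<..x + d}"
    using measure_Ioc_eq_fourier[of "x - d" "x + d"] e(1) by (simp add: d_def)
  also have "\<dots> \<le> 0" by simp
  finally show False by simp
qed

text \<open>Inversion treats bounded intervals; those from \<open>a\<close> to
  \<open>a + real n\<close> exhaust the rays \<open>{a<..}\<close>, which determine the
  measure.\<close>

theorem eq_density_fourier_char:
  "M = density lborel (\<lambda>x. ennreal (Re (fourier (char M) x) / (2 * pi)))"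
proof (rule measure_eqI_lessThan)
  let ?G = "\<lambda>x. Re (fourier (char M) x) / (2 * pi)"
  let ?N = "density lborel (\<lambda>x. ennreal (?G x))"
  have cont: "continuous_on UNIV ?G"
    using continuous_on_fourier[OF char_int] by (intro continuous_intros) auto
  then have [measurable]: "?G \<in> borel_measurable borel"
    by (rule borel_measurable_continuous_onI)
  show "emeasure M {a<..} = emeasure ?N {a<..}" for a
  proof -
    have Ioc: "emeasure M {a<..a + real n} = emeasure ?N {a<..a + real n}" for n
    proof -
      have "emeasure M {a<..a + real n} = ennreal (\<integral>x. ?G x * indicator {a..a + real n} x \<partial>lborel)"
        using measure_Ioc_eq_fourier[of a "a + real n"] by (simp add: emeasure_eq_measure)
      also have "\<dots> = (\<integral>\<^sup>+x. ennreal (?G x * indicator {a..a + real n} x) \<partial>lborel)"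
        using integrable_continuous_mult_indicator[OF cont] Re_fourier_char_nonneg
        by (intro nn_integral_eq_integral[symmetric] AE_I2) auto
      also have "\<dots> = (\<integral>\<^sup>+x. ennreal (?G x) * indicator {a<..a + real n} x \<partial>lborel)"
      proof (rule nn_integral_cong_AE)
        show "AE x in lborel. ennreal (?G x * indicator {a..a + real n} x) = ennreal (?G x) * indicator {a<..a + real n} x"
          by (rule AE_lborel_finite[of "{a}"]) (auto simp: indicator_def)
      qed
      also have "\<dots> = emeasure ?N {a<..a + real n}"
        by (simp add: emeasure_density)
      finally show ?thesis .
    qed
    have Un: "(\<Union>n. {a<..a + real n}) = {a<..}"
    proof (intro set_eqI iffI)
      fix x assume "x \<in> {a<..}"
      moreover obtain n where "x - a \<le> real n" using real_arch_simple by blast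
      ultimately show "x \<in> (\<Union>n. {a<..a + real n})" by (auto intro!: exI[of _ n])
    qed auto
    have rng: "range (\<lambda>n. {a<..a + real n}) \<subseteq> sets borel"
      by (intro image_subsetI greaterThanAtMost_borel)
    have inc: "incseq (\<lambda>n. {a<..a + real n})" by (auto simp: incseq_def)
    have "(\<lambda>n. emeasure M {a<..a + real n}) \<longlonglongrightarrow> emeasure M {a<..}"
      using Lim_emeasure_incseq[OF _ inc, of M] rng by (simp add: Un)
    moreover have "(\<lambda>n. emeasure M {a<..a + real n}) \<longlonglongrightarrow> emeasure ?N {a<..}"
      unfolding Ioc using Lim_emeasure_incseq[OF _ inc, of ?N] rng by (simp add: Un)
    ultimately show ?thesis by (rule LIMSEQ_unique)
  qed
qed (auto simp: emeasure_eq_measure)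

end
end

section \<open>Transforms of derivatives, and rapidly decreasing functions\<close>

text \<open>Integration by parts: the derivative of \<open>iexp (- (t * x)) * \<psi> t\<close> in
  \<open>t\<close> integrates to 0 over the line because \<open>\<psi>\<close> vanishes at both
  ends.\<close>

lemma times_fourier:
  assumes \<psi>: "integrable lborel \<psi>" and \<psi>': "integrable lborel \<psi>'"
    and deriv: "\<And>t. (\<psi> has_vector_derivative \<psi>' t) (at t)"
    and cont: "continuous_on UNIV \<psi>'"
    and lim: "(\<psi> \<longlongrightarrow> 0) at_top" "(\<psi> \<longlongrightarrow> 0) at_bot"
  shows "\<i> * x * fourier \<psi> x = fourier \<psi>' x"
proof -
  let ?D = "\<lambda>t. iexp (- (t * x)) * \<psi>' t - \<i> * x * (iexp (- (t * x)) * \<psi> t)"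
  have int: "integrable lborel ?D"
    using fourier_integrable[OF \<psi>, of x] fourier_integrable[OF \<psi>', of x] by simp
  have \<psi>_cont: "continuous_on UNIV \<psi>"
    using deriv by (auto intro!: continuous_at_imp_continuous_on has_vector_derivative_continuous)
  have lim0: "((\<lambda>t. iexp (- (t * x)) * \<psi> t) \<longlongrightarrow> 0) F" if "(\<psi> \<longlongrightarrow> 0) F" for F
    using that by (subst tendsto_norm_zero_iff[symmetric]) (simp add: tendsto_norm_zero)
  have "(LBINT t=-\<infinity>..\<infinity>. ?D t) = 0 - 0"
  proof (rule interval_integral_FTC_integrable[where F="\<lambda>t. iexp (- (t * x)) * \<psi> t"])
    show "((\<lambda>t. iexp (- (t * x)) * \<psi> t) has_vector_derivative ?D t) (at t)" for t
    proof -
      have "((\<lambda>t. exp (- (\<i> * complex_of_real t * x))) has_vector_derivative exp (- (\<i> * t * x)) * (- \<i> * x)) (at t)"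
        by (rule has_vector_derivative_real_field) (auto intro!: derivative_eq_intros)
      from has_vector_derivative_mult[OF this deriv[of t]] show ?thesis
        by (simp add: mult_ac)
    qed
    show "isCont ?D t" for t
      using cont \<psi>_cont by (intro continuous_intros) (auto simp: continuous_on_eq_continuous_at)
    show "set_integrable lborel (einterval (-\<infinity>) \<infinity>) ?D"
      using int by (simp add: set_integrable_def)
    show "(((\<lambda>t. iexp (- (t * x)) * \<psi> t) \<circ> real_of_ereal) \<longlongrightarrow> 0) (at_right (-\<infinity>))"
      using lim0[OF lim(2)] by (simp only: ereal_tendsto_simps1)
    show "(((\<lambda>t. iexp (- (t * x)) * \<psi> t) \<circ> real_of_ereal) \<longlongrightarrow> 0) (at_left \<infinity>)"
      using lim0[OF lim(1)] by (simp only: ereal_tendsto_simps1)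
  qed simp
  then have "(\<integral>t. ?D t \<partial>lborel) = 0"
    by (simp add: interval_lebesgue_integral_def set_lebesgue_integral_def)
  then show ?thesis
    using fourier_integrable[OF \<psi>, of x] fourier_integrable[OF \<psi>', of x]
    by (simp add: fourier_def)
qed

text \<open>The decay of a Schwartz function without its conditions on derivatives: decay alone
  governs the smoothness of the transform.\<close>

definition rapidly_decreasing :: "(real \<Rightarrow> complex) \<Rightarrow> bool" where
  "rapidly_decreasing \<phi> \<longleftrightarrow> continuous_on UNIV \<phi> \<and> (\<forall>n. \<exists>C. \<forall>t. \<bar>t\<bar> ^ n * cmod (\<phi> t) \<le> C)"

text \<open>The cases \<open>n = 0\<close> and \<open>n = 2\<close> together give a multiple of the
  integrable function \<open>inverse (1 + t\<^sup>2)\<close>.\<close>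

lemma rapidly_decreasing_integrable:
  assumes "rapidly_decreasing \<phi>"
  shows "integrable lborel \<phi>"
proof -
  obtain C0 C2 where C: "\<And>t. cmod (\<phi> t) \<le> C0" "\<And>t. \<bar>t\<bar> ^ 2 * cmod (\<phi> t) \<le> C2"
    using assms unfolding rapidly_decreasing_def by (metis mult_1 power_0)
  show ?thesis
  proof (rule Bochner_Integration.integrable_bound)
    show "integrable lborel (\<lambda>t. (C0 + C2) * inverse (1 + t\<^sup>2))"
      using integrable_inverse_1_plus_square by (simp add: set_integrable_def)
    show "\<phi> \<in> borel_measurable lborel"
      using assms by (auto simp: rapidly_decreasing_def intro: borel_measurable_continuous_onI)
    show "AE t in lborel. norm (\<phi> t) \<le> norm ((C0 + C2) * inverse (1 + t\<^sup>2))"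
    proof (rule AE_I2)
      fix t :: real
      have "0 < 1 + t\<^sup>2" by (simp add: add_pos_nonneg)
      moreover have "cmod (\<phi> t) * (1 + t\<^sup>2) \<le> C0 + C2"
        using C(1)[of t] C(2)[of t] by (simp add: algebra_simps)
      ultimately have "cmod (\<phi> t) \<le> (C0 + C2) * inverse (1 + t\<^sup>2)"
        by (simp add: field_simps)
      then show "norm (\<phi> t) \<le> norm ((C0 + C2) * inverse (1 + t\<^sup>2))" by simp
    qed
  qed
qed

lemma rapidly_decreasing_mult_id:
  assumes "rapidly_decreasing \<phi>"
  shows "rapidly_decreasing (\<lambda>t. - \<i> * t * \<phi> t)"
  unfolding rapidly_decreasing_def
proof (intro conjI allI)
  fix n
  obtain C where "\<And>t. \<bar>t\<bar> ^ Suc n * cmod (\<phi> t) \<le> C"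
    using assms unfolding rapidly_decreasing_def by blast
  then show "\<exists>C. \<forall>t. \<bar>t\<bar> ^ n * cmod (- \<i> * t * \<phi> t) \<le> C"
    by (auto simp: norm_mult mult_ac intro!: exI[of _ C])
qed (use assms in \<open>auto simp: rapidly_decreasing_def intro!: continuous_intros\<close>)

lemma rapidly_decreasing_mult_bounded:
  assumes \<phi>: "rapidly_decreasing \<phi>" and h: "continuous_on UNIV h" "\<And>t. cmod (h t) \<le> B"
  shows "rapidly_decreasing (\<lambda>t. h t * \<phi> t)"
  unfolding rapidly_decreasing_def
proof (intro conjI allI)
  fix n
  obtain C where C: "\<And>t. \<bar>t\<bar> ^ n * cmod (\<phi> t) \<le> C"
    using assms unfolding rapidly_decreasing_def by blast
  have "\<bar>t\<bar> ^ n * cmod (h t * \<phi> t) \<le> B * C" for t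
  proof -
    have "\<bar>t\<bar> ^ n * cmod (h t * \<phi> t) = cmod (h t) * (\<bar>t\<bar> ^ n * cmod (\<phi> t))"
      by (simp add: norm_mult)
    also have "\<dots> \<le> B * C"
      using C[of t] h(2)[of t] order_trans[OF norm_ge_zero h(2)] by (intro mult_mono) auto
    finally show ?thesis .
  qed
  then show "\<exists>C. \<forall>t. \<bar>t\<bar> ^ n * cmod (h t * \<phi> t) \<le> C" by blast
qed (use assms in \<open>auto simp: rapidly_decreasing_def intro!: continuous_intros\<close>)

lemma rapidly_decreasing_cmult:
  assumes "rapidly_decreasing \<phi>"
  shows "rapidly_decreasing (\<lambda>t. c * \<phi> t)"
  using rapidly_decreasing_mult_bounded[OF assms, of "\<lambda>_. c" "cmod c"] by simp

lemma rapidly_decreasing_add: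
  assumes "rapidly_decreasing \<phi>" "rapidly_decreasing \<psi>"
  shows "rapidly_decreasing (\<lambda>t. \<phi> t + \<psi> t)"
  unfolding rapidly_decreasing_def
proof (intro conjI allI)
  fix n
  obtain C D where CD: "\<And>t. \<bar>t\<bar> ^ n * cmod (\<phi> t) \<le> C" "\<And>t. \<bar>t\<bar> ^ n * cmod (\<psi> t) \<le> D"
    using assms unfolding rapidly_decreasing_def by metis
  have "\<bar>t\<bar> ^ n * cmod (\<phi> t + \<psi> t) \<le> C + D" for t
  proof -
    have "\<bar>t\<bar> ^ n * cmod (\<phi> t + \<psi> t) \<le> \<bar>t\<bar> ^ n * (cmod (\<phi> t) + cmod (\<psi> t))"
      by (intro mult_left_mono norm_triangle_ineq) auto
    also have "\<dots> \<le> C + D" using CD[of t] by (simp add: distrib_left)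
    finally show ?thesis .
  qed
  then show "\<exists>C. \<forall>t. \<bar>t\<bar> ^ n * cmod (\<phi> t + \<psi> t) \<le> C" by blast
qed (use assms in \<open>auto simp: rapidly_decreasing_def intro!: continuous_intros\<close>)

lemma rapidly_decreasing_tendsto_0:
  assumes "rapidly_decreasing \<phi>"
  shows "(\<phi> \<longlongrightarrow> 0) at_top" "(\<phi> \<longlongrightarrow> 0) at_bot"
proof -
  obtain C where "\<And>t. \<bar>t\<bar> ^ 1 * cmod (\<phi> t) \<le> C"
    using assms unfolding rapidly_decreasing_def by blast
  then have C: "cmod (\<phi> t) \<le> C / \<bar>t\<bar>" if "t \<noteq> 0" for t
    using that by (simp add: field_simps)
  have "filterlim (\<lambda>t::real. norm t) at_infinity at_infinity"
    by (intro filterlim_at_top_imp_at_infinity filterlim_norm_at_top)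
  then have "filterlim (\<lambda>t::real. \<bar>t\<bar>) at_infinity at_infinity"
    by (simp only: real_norm_def)
  then have "((\<lambda>t::real. C / \<bar>t\<bar>) \<longlongrightarrow> 0) at_infinity"
    by (rule tendsto_divide_0[OF tendsto_const])
  then have lim: "((\<lambda>t. C / \<bar>t\<bar>) \<longlongrightarrow> 0) at_top" "((\<lambda>t. C / \<bar>t\<bar>) \<longlongrightarrow> 0) at_bot"
    using at_top_le_at_infinity at_bot_le_at_infinity by (auto intro: tendsto_mono)
  show "(\<phi> \<longlongrightarrow> 0) at_top"
    by (rule Lim_null_comparison[OF eventually_mono[OF eventually_gt_at_top[of 0]] lim(1)]) (rule C, simp)
  show "(\<phi> \<longlongrightarrow> 0) at_bot"
    by (rule Lim_null_comparison[OF eventually_mono[OF eventually_gt_at_bot[of 0]] lim(2)]) (rule C, simp)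
qed

lemma rapidly_decreasing_stretched_exponential:
  assumes cont: "continuous_on UNIV \<phi>" and "0 < c" "0 < \<beta>"
    and le_1: "\<And>t. cmod (\<phi> t) \<le> 1"
    and bound: "\<And>t. 1 \<le> \<bar>t\<bar> \<Longrightarrow> cmod (\<phi> t) \<le> exp (- c * \<bar>t\<bar> powr \<beta>)"
  shows "rapidly_decreasing \<phi>"
  unfolding rapidly_decreasing_def
proof (intro conjI allI cont)
  fix n :: nat
  \<comment> \<open>With \<open>s = \<bar>t\<bar> powr \<beta>\<close>,
    \<open>N \<ge> n / \<beta>\<close> gives \<open>\<bar>t\<bar> ^ n \<le> s ^ N\<close>, and
    \<open>N \<ge> 1\<close> allows \<open>(1 + c * s / N) ^ N \<le> exp (c * s)\<close>; hence
    \<open>s ^ N * exp (- c * s) \<le> (N / c) ^ N\<close>.\<close>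
  obtain N :: nat where N: "real n / \<beta> \<le> real N" "1 \<le> N"
    using real_arch_simple[of "max 1 (real n / \<beta>)"] by auto
  define C where "C = max 1 ((real N / c) ^ N)"
  have "\<bar>t\<bar> ^ n * cmod (\<phi> t) \<le> C" for t
  proof (cases "1 \<le> \<bar>t\<bar>")
    case True
    define s where "s = \<bar>t\<bar> powr \<beta>"
    have "0 \<le> s" by (simp add: s_def)
    have "\<bar>t\<bar> ^ n = \<bar>t\<bar> powr real n"
      using True by (simp add: powr_realpow)
    also have "\<dots> \<le> \<bar>t\<bar> powr (\<beta> * real N)"
      using True N \<open>0 < \<beta>\<close> by (intro powr_mono) (auto simp: field_simps)
    also have "\<dots> = s ^ N"
      using True by (simp add: s_def powr_powr[symmetric] powr_realpow)
    finally have "\<bar>t\<bar> ^ n * cmod (\<phi> t) \<le> s ^ N * exp (- c * s)"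
      using bound[OF True] \<open>0 \<le> s\<close> by (intro mult_mono) (auto simp: s_def)
    also have "\<dots> \<le> (real N / c) ^ N"
    proof -
      have "(c * s / real N) ^ N \<le> (1 + c * s / real N) ^ N"
        using \<open>0 < c\<close> \<open>0 \<le> s\<close> by (intro power_mono) auto
      also have "\<dots> \<le> exp (c * s)"
      proof (rule exp_ge_one_plus_x_over_n_power_n)
        have "0 \<le> c * s" using \<open>0 < c\<close> \<open>0 \<le> s\<close> by simp
        then show "- real N \<le> c * s" by linarith
      qed (use N(2) in simp)
      finally have "(c * s / real N) ^ N * (real N / c) ^ N \<le> exp (c * s) * (real N / c) ^ N"
        using \<open>0 < c\<close> by (intro mult_right_mono) auto
      then have "s ^ N \<le> exp (c * s) * (real N / c) ^ N"
        using N(2) \<open>0 < c\<close> by (simp flip: power_mult_distrib)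
      then show ?thesis by (simp add: exp_minus field_simps)
    qed
    finally show ?thesis by (simp add: C_def)
  next
    case False
    then have "\<bar>t\<bar> ^ n * cmod (\<phi> t) \<le> 1"
      using le_1[of t] by (intro mult_le_one power_le_one) auto
    then show ?thesis by (simp add: C_def)
  qed
  then show "\<exists>C. \<forall>t. \<bar>t\<bar> ^ n * cmod (\<phi> t) \<le> C" by blast
qed

lemma Gamma_rate_integral:
  assumes "0 < s" "0 < (l::real)"
  shows "has_bochner_integral lborel (\<lambda>y. y powr (s - 1) * exp (- l * y) * indicator {0<..} y) (Gamma s / l powr s)"
proof (rule has_bochner_integral_nn_integral)
  show "0 \<le> Gamma s / l powr s" using assms by (simp add: Gamma_real_nonneg)
  have eq: "ennreal ((0 + (1 / l) * y) powr (s - 1) * exp (- l * (0 + (1 / l) * y)) * indicator {0<..} (0 + (1 / l) * y))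
      = ennreal (l powr (1 - s)) * ennreal (indicator {0..} y * y powr (s - 1) / exp y)" for y
  proof (cases "0 < y")
    case True
    then show ?thesis
      using assms by (subst ennreal_mult[symmetric])
        (auto simp: powr_divide powr_diff exp_minus field_simps)
  next
    case False
    then show ?thesis using assms by (cases "y = 0") (auto simp: zero_less_divide_iff)
  qed
  have "(\<integral>\<^sup>+y. ennreal (y powr (s - 1) * exp (- l * y) * indicator {0<..} y) \<partial>lborel)
      = ennreal \<bar>1 / l\<bar> * (\<integral>\<^sup>+y. ennreal ((0 + (1 / l) * y) powr (s - 1) * exp (- l * (0 + (1 / l) * y)) * indicator {0<..} (0 + (1 / l) * y)) \<partial>lborel)"
    using assms by (intro nn_integral_real_affine) auto
  also have "\<dots> = ennreal (1 / l) * (ennreal (l powr (1 - s)) * ennreal (Gamma s))"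
    unfolding eq Gamma_conv_nn_integral_real[OF assms(1)] using assms by (simp add: nn_integral_cmult)
  also have "\<dots> = ennreal (Gamma s / l powr s)"
    using assms by (simp add: ennreal_mult[symmetric] Gamma_real_nonneg powr_diff field_simps)
  finally show "(\<integral>\<^sup>+y. ennreal (y powr (s - 1) * exp (- l * y) * indicator {0<..} y) \<partial>lborel) = ennreal (Gamma s / l powr s)" .
qed auto

section \<open>The tempered stable distribution\<close>

locale ts_parameters =
  fixes \<alpha> \<beta> lam :: real
  assumes alpha_pos: "0 < \<alpha>" and lam_pos: "0 < lam" and beta_pos: "0 < \<beta>" and beta_less_1: "\<beta> < 1"
begin

section \<open>The Levy density, its exponent and the characteristic function\<close>

definition levy :: "real \<Rightarrow> real" where
  "levy y = \<alpha> / y powr (1 + \<beta>) * exp (- lam * y) * indicator {0<..} y"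

text \<open>Equal to \<open>levy y * y\<close>: the extra power of \<open>y\<close> makes the kernel
  integrable at 0, which \<open>levy\<close> is not.\<close>

definition k :: "real \<Rightarrow> real" where
  "k y = \<alpha> * (y powr (- \<beta>) * exp (- lam * y) * indicator {0<..} y)"

lemma levy_measurable [measurable]: "levy \<in> borel_measurable borel"
  unfolding levy_def by measurable

lemma k_measurable [measurable]: "k \<in> borel_measurable borel"
  unfolding k_def by measurable

lemma levy_nonneg: "0 \<le> levy y"
  using alpha_pos by (auto simp: levy_def indicator_def)

lemma k_zero: "y \<le> 0 \<Longrightarrow> k y = 0"
  by (simp add: k_def)

lemma k_nonneg: "0 \<le> k y"
  using alpha_pos by (auto simp: k_def indicator_def)

lemma levy_times: "levy y * y = k y"
  by (cases "0 < y") (auto simp: levy_def k_def powr_add powr_minus field_simps)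

lemma k_has_integral: "has_bochner_integral lborel k (Gamma (1 - \<beta>) * (\<alpha> / lam powr (1 - \<beta>)))"
  using has_bochner_integral_mult_right[of \<alpha>, OF Gamma_rate_integral[of "1 - \<beta>" lam]]
    alpha_pos lam_pos beta_less_1
  by (simp add: k_def[abs_def] mult_ac)

lemma times_k_has_integral:
  "has_bochner_integral lborel (\<lambda>y. y * k y) (Gamma (2 - \<beta>) * (\<alpha> / lam powr (2 - \<beta>)))"
proof -
  have "y * k y = \<alpha> * (y powr (2 - \<beta> - 1) * exp (- lam * y) * indicator {0<..} y)" for y
    by (cases "0 < y") (auto simp: k_def powr_diff powr_minus field_simps)
  then show ?thesis
    using has_bochner_integral_mult_right[of \<alpha>, OF Gamma_rate_integral[of "2 - \<beta>" lam]]
      alpha_pos lam_pos beta_less_1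
    by (simp add: mult_ac)
qed

lemma k_integrable: "integrable lborel k"
  using k_has_integral by (simp add: has_bochner_integral_iff)

definition \<Psi> :: "real \<Rightarrow> complex" where
  "\<Psi> z = (\<integral>y. levy y *\<^sub>R (iexp (z * y) - 1) \<partial>lborel)"

definition K :: "real \<Rightarrow> complex" where
  "K z = (\<integral>y. iexp (z * y) * k y \<partial>lborel)"

definition \<phi> :: "real \<Rightarrow> complex" where
  "\<phi> z = exp (\<Psi> z)"

lemma ts_levy_measure_integral:
  "(CLINT x | ts_levy_measure \<alpha> \<beta> lam. (iexp (z * x) - 1)) = \<Psi> z"
proof -
  have "ts_levy_measure \<alpha> \<beta> lam = density lborel (\<lambda>x. ennreal (levy x))"
    by (simp add: ts_levy_measure_def levy_def)
  then show ?thesis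
    unfolding \<Psi>_def by (simp add: integral_density levy_nonneg)
qed

lemma norm_exp_i_times' [simp]: "cmod (exp (\<i> * (complex_of_real a * complex_of_real b))) = 1"
  by (simp add: norm_exp_eq_Re)

text \<open>The bound \<open>cmod (iexp (z * y) - 1) \<le> \<bar>z * y\<bar>\<close> supplies the
  factor \<open>y\<close> that turns \<open>levy\<close> into the integrable
  \<open>k\<close>.\<close>

lemma \<Psi>_integrable: "integrable lborel (\<lambda>y. levy y *\<^sub>R (iexp (z * y) - 1))"
proof (rule Bochner_Integration.integrable_bound)
  show "integrable lborel (\<lambda>y. \<bar>z\<bar> * k y)" using k_integrable by simp
  show "AE y in lborel. norm (levy y *\<^sub>R (iexp (z * y) - 1)) \<le> norm (\<bar>z\<bar> * k y)"
  proof (rule AE_I2)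
    fix y
    have "norm (levy y *\<^sub>R (iexp (z * y) - 1)) \<le> levy y * \<bar>z * y\<bar>"
      using iexp_approx1[of "z * y" 0] levy_nonneg[of y] by (auto intro!: mult_left_mono)
    also have "\<dots> = \<bar>z\<bar> * \<bar>levy y * y\<bar>"
      using levy_nonneg[of y] by (simp add: abs_mult)
    finally show "norm (levy y *\<^sub>R (iexp (z * y) - 1)) \<le> norm (\<bar>z\<bar> * k y)"
      by (simp add: levy_times abs_mult)
  qed
qed measurable

lemma \<Psi>_has_vector_derivative: "(\<Psi> has_vector_derivative \<i> * K z) (at z)"
proof -
  have "(\<Psi> has_vector_derivative (\<integral>y. levy y *\<^sub>R (\<i> * y * iexp (z * y)) \<partial>lborel)) (at z)"
    unfolding \<Psi>_def
  proof (rule has_vector_derivative_integral[where w=k])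
    show "((\<lambda>z. levy y *\<^sub>R (iexp (z * y) - 1)) has_vector_derivative levy y *\<^sub>R (\<i> * y * iexp (z * y))) (at z)" for z y
    proof -
      have "((\<lambda>z. levy y * (exp (\<i> * complex_of_real z * y) - 1)) has_vector_derivative
          levy y * (\<i> * y * exp (\<i> * z * y))) (at z)"
        by (rule has_vector_derivative_real_field) (auto intro!: derivative_eq_intros)
      then show ?thesis by (simp add: scaleR_conv_of_real mult_ac)
    qed
    show "norm (levy y *\<^sub>R (\<i> * y * iexp (z * y))) \<le> k y" for z y
    proof -
      have "norm (levy y *\<^sub>R (\<i> * y * iexp (z * y))) = \<bar>levy y * y\<bar>"
        by (simp add: norm_mult abs_mult)
      then show ?thesis by (simp add: levy_times k_nonneg)
    qed
  qed (use \<Psi>_integrable k_integrable in auto)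
  also have "(\<integral>y. levy y *\<^sub>R (\<i> * y * iexp (z * y)) \<partial>lborel) = (\<integral>y. \<i> * (iexp (z * y) * k y) \<partial>lborel)"
  proof (rule Bochner_Integration.integral_cong)
    fix y
    have "levy y *\<^sub>R (\<i> * y * iexp (z * y)) = \<i> * (iexp (z * y) * complex_of_real (levy y * y))"
      by (simp add: scaleR_conv_of_real mult_ac)
    then show "levy y *\<^sub>R (\<i> * y * iexp (z * y)) = \<i> * (iexp (z * y) * k y)"
      by (simp only: levy_times)
  qed simp
  also have "\<dots> = \<i> * K z" by (simp add: K_def)
  finally show ?thesis .
qed

lemma K_continuous: "continuous_on UNIV K"
  unfolding K_def
  by (rule continuous_on_integral_dominated[where w=k])
    (auto intro!: continuous_intros simp: norm_mult k_nonneg k_integrable)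

lemma K_bounded: "cmod (K z) \<le> integral\<^sup>L lborel k"
  unfolding K_def using integral_norm_bound[of lborel "\<lambda>y. iexp (z * y) * k y"]
  by (simp add: norm_mult k_nonneg)

lemma \<phi>_has_vector_derivative: "(\<phi> has_vector_derivative \<i> * K z * \<phi> z) (at z)"
proof -
  have "((exp \<circ> \<Psi>) has_vector_derivative (\<i> * K z) * exp (\<Psi> z)) (at z)"
    by (rule field_vector_diff_chain_at[OF \<Psi>_has_vector_derivative]) (rule DERIV_exp)
  then show ?thesis by (simp add: \<phi>_def[abs_def] o_def)
qed

lemma \<phi>_continuous: "continuous_on UNIV \<phi>"
  using \<phi>_has_vector_derivative
  by (auto intro!: continuous_at_imp_continuous_on has_vector_derivative_continuous)

lemma Re_\<Psi>: "Re (\<Psi> z) = - (\<integral>y. levy y * (1 - cos (z * y)) \<partial>lborel)"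
  and Re_\<Psi>_integrable: "integrable lborel (\<lambda>y. levy y * (1 - cos (z * y)))"
proof -
  have eq: "Re (levy y *\<^sub>R (iexp (z * y) - 1)) = - (levy y * (1 - cos (z * y)))" for y
    by (simp add: Re_exp algebra_simps)
  show "integrable lborel (\<lambda>y. levy y * (1 - cos (z * y)))"
    using integrable_Re[OF \<Psi>_integrable[of z]] unfolding eq by simp
  show "Re (\<Psi> z) = - (\<integral>y. levy y * (1 - cos (z * y)) \<partial>lborel)"
    unfolding \<Psi>_def integral_Re[OF \<Psi>_integrable, symmetric] eq by simp
qed

text \<open>On the window \<open>1/2 \<le> \<bar>z\<bar> y \<le> 1\<close> the Levy density is of order \<open>\<bar>z\<bar> powr (1 + \<beta>)\<close>
  and \<open>1 - cos (z y)\<close> is bounded away from zero.\<close>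

lemma Re_\<Psi>_le:
  assumes "1 \<le> \<bar>z\<bar>"
  shows "Re (\<Psi> z) \<le> - (\<alpha> * exp (- lam) * (1 - cos (1/2)) / 2) * \<bar>z\<bar> powr \<beta>"
proof -
  define c where "c = \<alpha> * exp (- lam) * (1 - cos (1/2))"
  have "cos (1/2 :: real) \<le> 1" by simp
  then have "0 \<le> c" using alpha_pos by (simp add: c_def)
  define a b where "a = 1 / (2 * \<bar>z\<bar>)" and "b = 1 / \<bar>z\<bar>"
  \<comment> \<open>\<open>b \<le> 1\<close>, where \<open>1 \<le> \<bar>z\<bar>\<close> enters,
    keeps \<open>exp (- lam * y) \<ge> exp (- lam)\<close> on the window; its length
    \<open>1 / (2 * \<bar>z\<bar>)\<close> lowers the exponent \<open>1 + \<beta>\<close> to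
    \<open>\<beta>\<close>.\<close>
  have ab: "0 < a" "a \<le> b" "b \<le> 1" "b - a = 1 / (2 * \<bar>z\<bar>)"
    using assms by (auto simp: a_def b_def field_simps)
  have "c / 2 * \<bar>z\<bar> powr \<beta> = c * \<bar>z\<bar> powr (1 + \<beta>) * (b - a)"
    using assms ab(4) by (simp add: powr_add)
  also have "\<dots> = (\<integral>y. c * \<bar>z\<bar> powr (1 + \<beta>) * indicator {a..b} y \<partial>lborel)"
    using ab by simp
  also have "\<dots> \<le> (\<integral>y. levy y * (1 - cos (z * y)) \<partial>lborel)"
  proof (rule integral_mono)
    show "integrable lborel (\<lambda>y. c * \<bar>z\<bar> powr (1 + \<beta>) * indicator {a..b} y)"
      by (intro integrable_mult_right integrable_real_indicator) (auto simp: emeasure_lborel_Icc_eq)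
    show "c * \<bar>z\<bar> powr (1 + \<beta>) * indicator {a..b} y \<le> levy y * (1 - cos (z * y))" for y
    proof (cases "y \<in> {a..b}")
      case True
      then have "0 < y" "y \<le> 1" using ab by auto
      have zy: "1/2 \<le> \<bar>z\<bar> * y" "\<bar>z\<bar> * y \<le> 1"
        using True assms by (auto simp: a_def b_def field_simps)
      have "cos (z * y) = cos (\<bar>z\<bar> * y)" by (cases "0 \<le> z") auto
      also have "\<dots> \<le> cos (1/2)"
        using zy pi_gt3 by (intro cos_monotone_0_pi_le) auto
      finally have 1: "1 - cos (1/2) \<le> 1 - cos (z * y)" by simp
      have "y powr (1 + \<beta>) \<le> b powr (1 + \<beta>)"
        using True \<open>0 < y\<close> beta_pos by (intro powr_mono2) auto
      also have "\<dots> = inverse (\<bar>z\<bar> powr (1 + \<beta>))"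
        by (simp add: b_def powr_divide inverse_eq_divide)
      finally have "\<bar>z\<bar> powr (1 + \<beta>) \<le> inverse (y powr (1 + \<beta>))"
        using le_imp_inverse_le[of "y powr (1 + \<beta>)" "inverse (\<bar>z\<bar> powr (1 + \<beta>))"] \<open>0 < y\<close> by simp
      moreover have "exp (- lam) \<le> exp (- lam * y)"
        using \<open>y \<le> 1\<close> lam_pos by (simp add: mult_left_le)
      ultimately have "\<bar>z\<bar> powr (1 + \<beta>) * exp (- lam) \<le> inverse (y powr (1 + \<beta>)) * exp (- lam * y)"
        by (intro mult_mono) auto
      then have "\<alpha> * (\<bar>z\<bar> powr (1 + \<beta>) * exp (- lam)) \<le> \<alpha> * (inverse (y powr (1 + \<beta>)) * exp (- lam * y))"
        using alpha_pos by (intro mult_left_mono) auto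
      also have "\<dots> = levy y"
        using \<open>0 < y\<close> by (simp add: levy_def divide_inverse)
      finally have "(\<alpha> * (\<bar>z\<bar> powr (1 + \<beta>) * exp (- lam))) * (1 - cos (1/2)) \<le> levy y * (1 - cos (z * y))"
        using 1 levy_nonneg by (intro mult_mono) auto
      then show ?thesis using True by (simp add: c_def mult_ac)
    qed (simp add: levy_nonneg)
  qed (rule Re_\<Psi>_integrable)
  finally show ?thesis by (simp add: Re_\<Psi> c_def)
qed

lemma \<phi>_rapidly_decreasing: "rapidly_decreasing \<phi>"
proof (rule rapidly_decreasing_stretched_exponential[OF \<phi>_continuous])
  have "cos (1/2) < cos (0::real)"
    using pi_gt3 by (intro cos_monotone_0_pi) auto
  then show "0 < \<alpha> * exp (- lam) * (1 - cos (1/2)) / 2" using alpha_pos by simp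
  show "cmod (\<phi> t) \<le> exp (- (\<alpha> * exp (- lam) * (1 - cos (1/2)) / 2) * \<bar>t\<bar> powr \<beta>)" if "1 \<le> \<bar>t\<bar>" for t
    using Re_\<Psi>_le[OF that] by (simp add: \<phi>_def norm_exp_eq_Re)
  show "cmod (\<phi> t) \<le> 1" for t
    using levy_nonneg by (simp add: \<phi>_def norm_exp_eq_Re Re_\<Psi>)
qed (rule beta_pos)

section \<open>The density and its derivatives by Fourier inversion\<close>

definition \<psi> :: "nat \<Rightarrow> real \<Rightarrow> complex" where
  "\<psi> n t = (- \<i> * t) ^ n * \<phi> t"

text \<open>The candidate for the \<open>n\<close>-th derivative of the density. It depends on the
  parameters alone; \<open>G 0\<close> becomes a density once a measure with characteristic function
  \<open>\<phi>\<close> is given.\<close>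

definition G :: "nat \<Rightarrow> real \<Rightarrow> real" where
  "G n x = Re (fourier (\<psi> n) x) / (2 * pi)"

lemma \<psi>_Suc: "\<psi> (Suc n) = (\<lambda>t. - \<i> * t * \<psi> n t)"
  by (simp add: \<psi>_def fun_eq_iff mult_ac)

lemma \<psi>_0: "\<psi> 0 = \<phi>"
  by (simp add: \<psi>_def fun_eq_iff)

lemma \<psi>_rapidly_decreasing: "rapidly_decreasing (\<psi> n)"
  by (induction n) (simp_all only: \<psi>_0 \<psi>_Suc \<phi>_rapidly_decreasing rapidly_decreasing_mult_id)

lemma \<psi>_integrable: "integrable lborel (\<psi> n)"
  using \<psi>_rapidly_decreasing by (rule rapidly_decreasing_integrable)

lemma G_deriv: "(G n has_real_derivative G (Suc n) x) (at x)"
proof -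
  have "(fourier (\<psi> n) has_vector_derivative fourier (\<psi> (Suc n)) x) (at x)"
    using fourier_has_vector_derivative[of "\<psi> n"] \<psi>_integrable[of n] \<psi>_integrable[of "Suc n"]
    by (simp add: \<psi>_Suc)
  then have "((\<lambda>x. Re (fourier (\<psi> n) x)) has_real_derivative Re (fourier (\<psi> (Suc n)) x)) (at x)"
    unfolding has_real_derivative_iff_has_vector_derivative
    by (rule bounded_linear.has_vector_derivative[OF bounded_linear_Re])
  then show ?thesis unfolding G_def by (rule DERIV_cdivide)
qed

lemma deriv_G: "(deriv ^^ n) (G m) = G (m + n)"
proof (induction n)
  case (Suc n)
  have "deriv (G (m + n)) = G (m + Suc n)"
    using DERIV_imp_deriv[OF G_deriv] by (simp add: fun_eq_iff)
  with Suc show ?case by simp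
qed simp

lemma G_C_infinity: "C_infinity (G 0)"
  unfolding C_infinity_def deriv_G differentiable_on_def
  using G_deriv real_differentiable_def by blast

text \<open>Fubini turns the convolution with \<open>k\<close> into the factor \<open>K t\<close>;
  used for \<open>n = 0\<close> and \<open>n = 1\<close>.\<close>

lemma fourier_convolution:
  "(\<integral>u. G n u * k (x - u) \<partial>lborel) = Re (fourier (\<lambda>t. K t * \<psi> n t) x) / (2 * pi)"
proof -
  have K: "(\<integral>y. iexp (- (t * (x - y))) * k y \<partial>lborel) = iexp (- (t * x)) * K t" for t
    unfolding K_def by (subst integral_mult_right_zero[symmetric])
      (simp add: exp_add[symmetric] algebra_simps)
  have int: "integrable lborel (\<lambda>y. fourier (\<psi> n) (x - y) * k y)"
    and eq: "(\<integral>y. fourier (\<psi> n) (x - y) * k y \<partial>lborel) = fourier (\<lambda>t. K t * \<psi> n t) x"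
    using integral_fourier_mult[OF \<psi>_integrable[of n] k_integrable, of "\<lambda>y. x - y"]
    unfolding K by (simp_all add: fourier_def[of "\<lambda>t. K t * \<psi> n t"] mult.assoc)
  have "(\<integral>u. G n u * k (x - u) \<partial>lborel) = (\<integral>y. G n (x - y) * k y \<partial>lborel)"
    by (subst lborel_integral_real_affine[where c="-1" and t=x]) simp_all
  also have "\<dots> = (\<integral>y. Re (fourier (\<psi> n) (x - y) * k y) / (2 * pi) \<partial>lborel)"
    by (simp add: G_def)
  also have "\<dots> = Re (fourier (\<lambda>t. K t * \<psi> n t) x) / (2 * pi)"
    using integral_Re[OF int] eq by simp
  finally show ?thesis .
qed

lemma K\<psi>_rapidly_decreasing: "rapidly_decreasing (\<lambda>t. K t * \<psi> n t)"
  using \<psi>_rapidly_decreasing K_continuous K_bounded by (rule rapidly_decreasing_mult_bounded)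

text \<open>The derivative of \<open>\<phi>\<close> is \<open>\<i> * K t * \<phi> t\<close>, and the
  transform turns a derivative into multiplication by \<open>\<i> * x\<close>; so both sides are the
  transform of \<open>K t * \<phi> t\<close>.\<close>

lemma G_conv: "x * G 0 x = (\<integral>u. G 0 u * k (x - u) \<partial>lborel)"
proof -
  have K\<phi>: "rapidly_decreasing (\<lambda>t. \<i> * (K t * \<phi> t))"
    using K\<psi>_rapidly_decreasing[of 0]
    by (intro rapidly_decreasing_cmult) (simp add: \<psi>_0)
  have "\<i> * x * fourier \<phi> x = fourier (\<lambda>t. \<i> * (K t * \<phi> t)) x"
    using \<phi>_rapidly_decreasing K\<phi> \<phi>_has_vector_derivative
    by (intro times_fourier rapidly_decreasing_integrable rapidly_decreasing_tendsto_0)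
      (auto simp: rapidly_decreasing_def mult.assoc)
  then have "x * fourier \<phi> x = fourier (\<lambda>t. K t * \<phi> t) x"
    unfolding fourier_cmult mult.assoc by simp
  from arg_cong[OF this, of Re] show ?thesis
    unfolding fourier_convolution unfolding G_def \<psi>_0 by simp
qed

text \<open>The same computation for \<open>\<psi> 1 t = - \<i> * t * \<phi> t\<close>: the product
  rule contributes the extra term \<open>- \<i> * \<phi> t\<close>, which accounts for
  \<open>G 0 x\<close>.\<close>

lemma G_conv': "G 0 x + x * G 1 x = (\<integral>u. G 1 u * k (x - u) \<partial>lborel)"
proof -
  let ?D = "\<lambda>t. - \<i> * \<phi> t + \<i> * (K t * \<psi> 1 t)"
  have r1: "rapidly_decreasing (\<lambda>t. - \<i> * \<phi> t)"
    using \<phi>_rapidly_decreasing by (rule rapidly_decreasing_cmult)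
  have r2: "rapidly_decreasing (\<lambda>t. \<i> * (K t * \<psi> 1 t))"
    using K\<psi>_rapidly_decreasing[of 1] by (rule rapidly_decreasing_cmult)
  have D: "rapidly_decreasing ?D" using r1 r2 by (rule rapidly_decreasing_add)
  have deriv: "(\<psi> 1 has_vector_derivative ?D t) (at t)" for t
  proof -
    have "((\<lambda>t. - \<i> * complex_of_real t) has_vector_derivative - \<i>) (at t)"
      by (rule has_vector_derivative_real_field) (auto intro!: derivative_eq_intros)
    from has_vector_derivative_mult[OF this \<phi>_has_vector_derivative] show ?thesis
      by (simp add: \<psi>_def[abs_def] algebra_simps)
  qed
  have "\<i> * x * fourier (\<psi> 1) x = fourier ?D x"
    using \<psi>_rapidly_decreasing[of 1] D deriv
    by (intro times_fourier rapidly_decreasing_integrable rapidly_decreasing_tendsto_0)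
      (auto simp: rapidly_decreasing_def)
  also have "\<dots> = fourier (\<lambda>t. - \<i> * \<phi> t) x + fourier (\<lambda>t. \<i> * (K t * \<psi> 1 t)) x"
    using r1 r2 by (intro fourier_add rapidly_decreasing_integrable)
  also have "\<dots> = \<i> * (- fourier \<phi> x + fourier (\<lambda>t. K t * \<psi> 1 t) x)"
    unfolding fourier_cmult by (simp add: algebra_simps)
  finally have "x * fourier (\<psi> 1) x = - fourier \<phi> x + fourier (\<lambda>t. K t * \<psi> 1 t) x"
    unfolding mult.assoc by simp
  from arg_cong[OF this, of Re] show ?thesis
    unfolding fourier_convolution unfolding G_def \<psi>_0 by (simp add: field_simps)
qed

section \<open>The level 1 of the kernel and the fixed point equation\<close>

lemma k_strict_antimono:
  assumes "0 < x" "x < y"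
  shows "k y < k x"
proof -
  have "y powr (- \<beta>) * exp (- lam * y) < x powr (- \<beta>) * exp (- lam * x)"
    using assms beta_pos lam_pos
    by (intro mult_strict_mono powr_less_mono2_neg) auto
  then show ?thesis using assms alpha_pos by (simp add: k_def)
qed

text \<open>\<open>k \<xi> = 1\<close> reads
  \<open>\<alpha> * exp (- lam * \<xi>) = \<xi> powr \<beta>\<close>, and the power
  \<open>1 / \<beta>\<close> gives the fixed point equation. This identifies the crossing point of
  the shape argument with the \<open>\<xi>0\<close> of the theorem.\<close>

lemma k_eq_1_iff:
  assumes "0 < \<xi>"
  shows "k \<xi> = 1 \<longleftrightarrow> \<alpha> powr (1 / \<beta>) * exp (- (lam / \<beta>) * \<xi>) = \<xi>"
proof -
  have "\<alpha> powr (1 / \<beta>) * exp (- (lam / \<beta>) * \<xi>) = (\<alpha> * exp (- lam * \<xi>)) powr (1 / \<beta>)"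
    using alpha_pos by (simp add: powr_mult exp_powr_real)
  moreover have "\<dots> = \<xi> \<longleftrightarrow> \<alpha> * exp (- lam * \<xi>) = \<xi> powr \<beta>"
  proof
    assume "(\<alpha> * exp (- lam * \<xi>)) powr (1 / \<beta>) = \<xi>"
    then have "\<xi> powr \<beta> = ((\<alpha> * exp (- lam * \<xi>)) powr (1 / \<beta>)) powr \<beta>" by simp
    also have "\<dots> = \<alpha> * exp (- lam * \<xi>)"
      unfolding powr_powr using beta_pos alpha_pos by simp
    finally show "\<alpha> * exp (- lam * \<xi>) = \<xi> powr \<beta>" by simp
  qed (use assms beta_pos in \<open>simp add: powr_powr\<close>)
  moreover have "\<dots> \<longleftrightarrow> k \<xi> = 1"
    using assms by (auto simp: k_def powr_minus field_simps)
  ultimately show ?thesis by simp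
qed

lemma fixed_point_exists: "\<exists>\<xi>>0. k \<xi> = 1"
proof -
  define A where "A = \<alpha> powr (1 / \<beta>)"
  have "0 < A" using alpha_pos by (simp add: A_def)
  have "\<exists>x\<ge>0. x \<le> A \<and> A * exp (- (lam / \<beta>) * x) - x = 0"
  proof (rule IVT2')
    show "A * exp (- (lam / \<beta>) * A) - A \<le> 0"
      using \<open>0 < A\<close> lam_pos beta_pos by (simp add: mult_left_le)
    show "continuous_on {0..A} (\<lambda>x. A * exp (- (lam / \<beta>) * x) - x)"
      by (intro continuous_intros)
  qed (use \<open>0 < A\<close> in auto)
  then obtain x where x: "0 \<le> x" "A * exp (- (lam / \<beta>) * x) = x" by auto
  then have "0 < x" using \<open>0 < A\<close> by (cases "x = 0") auto
  with x k_eq_1_iff[of x] show ?thesis by (auto simp: A_def)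
qed

text \<open>Bounding the exponential factor by 1 leaves a power with an explicit integral; this
  produces the bound \<open>(\<alpha> / (1 - \<beta>)) powr (1 / \<beta>)\<close> on the
  mode.\<close>

lemma k_initial_integral_le:
  assumes "0 \<le> x"
  shows "(\<integral>y. k y * indicator {0<..<x} y \<partial>lborel) \<le> \<alpha> * (x powr (1 - \<beta>) / (1 - \<beta>))"
proof -
  have "integrable lborel (\<lambda>y. k y * indicator {0<..<x} y)"
    using integrable_real_mult_indicator[OF _ k_integrable, of "{0<..<x}"] by simp
  then have "((\<lambda>y. k y * indicator {0<..<x} y) has_integral (\<integral>y. k y * indicator {0<..<x} y \<partial>lborel)) UNIV"
    by (rule has_integral_integral_lborel)
  moreover have "((\<lambda>y. if y \<in> {0..x} then \<alpha> * y powr (- \<beta>) else 0) has_integral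
      \<alpha> * (x powr (1 - \<beta>) / (1 - \<beta>))) UNIV"
    unfolding has_integral_restrict_UNIV
    using has_integral_mult_right[OF has_integral_powr_from_0[of "- \<beta>" x], of \<alpha>] beta_less_1 assms
    by simp
  ultimately show ?thesis
  proof (rule has_integral_le)
    fix y
    show "k y * indicator {0<..<x} y \<le> (if y \<in> {0..x} then \<alpha> * y powr (- \<beta>) else 0)"
      using alpha_pos lam_pos by (auto simp: k_def indicator_def mult_left_le)
  qed
qed

end

section \<open>The density of a given tempered stable distribution\<close>

locale ts_distribution = ts_parameters + real_distribution M for M +
  assumes char_eq: "char M = \<phi>"
begin

lemma char_integrable: "integrable lborel (char M)"
  unfolding char_eq using \<phi>_rapidly_decreasing by (rule rapidly_decreasing_integrable)

lemma G_nonneg: "0 \<le> G 0 x"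
  using Re_fourier_char_nonneg[OF char_integrable, of x] by (simp add: G_def \<psi>_0 char_eq)

lemma G_measurable [measurable]: "G n \<in> borel_measurable borel"
  using G_deriv by (intro borel_measurable_continuous_onI continuous_at_imp_continuous_on ballI DERIV_isCont)

lemma density_G: "M = density lborel (\<lambda>x. ennreal (G 0 x))"
  using eq_density_fourier_char[OF char_integrable] by (simp add: G_def \<psi>_0 char_eq)

lemma G_has_integral: "has_bochner_integral lborel (G 0) 1"
proof (rule has_bochner_integral_nn_integral)
  have "emeasure M (space M) = (\<integral>\<^sup>+x. ennreal (G 0 x) \<partial>lborel)"
    by (subst (1) density_G) (simp add: emeasure_density)
  then show "(\<integral>\<^sup>+x. ennreal (G 0 x) \<partial>lborel) = ennreal 1"
    using emeasure_space_1 by simp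
qed (simp_all add: G_nonneg)

text \<open>Both sides of \<open>x * g x = (g * k) x\<close> have opposite signs for negative \<open>x\<close>.\<close>

lemma G_zero: "G 0 x = 0" if "x \<le> 0"
proof -
  have neg: "G 0 x = 0" if "x < 0" for x
  proof -
    have "0 \<le> x * G 0 x"
      unfolding G_conv by (intro Bochner_Integration.integral_nonneg) (simp add: G_nonneg k_nonneg)
    then show ?thesis using that G_nonneg[of x] by (auto simp: zero_le_mult_iff)
  qed
  have "(G 0 \<longlongrightarrow> G 0 0) (at_left 0)"
    using DERIV_isCont[OF G_deriv, of 0 0] by (auto simp: isCont_def intro: tendsto_within_subset)
  moreover have "(G 0 \<longlongrightarrow> 0) (at_left 0)"
    by (rule tendsto_eventually) (auto simp: eventually_at_filter neg)
  ultimately have "G 0 0 = 0"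
    using tendsto_unique trivial_limit_at_left_real by blast
  with neg that show ?thesis by (cases "x = 0") auto
qed

lemma is_density_of_G: "is_density_of (G 0) M"
  using density_G by (simp add: is_density_of_def G_nonneg)

end

text \<open>The witnesses are the continuous density \<open>G 0\<close>, its first critical point as
  \<open>x0\<close>, and the point where \<open>k\<close> equals 1 as \<open>\<xi>0\<close>. The
  density vanishes on the negative half-line, so \<open>deriv g\<close> is 0 up to and including the
  origin, and its positivity can only hold on \<open>{0<..<x0}\<close>.\<close>

theorem theorem7p1:
  fixes \<alpha> \<beta> lam :: real and \<eta> :: "real measure"
  assumes "0 < \<alpha>" and "0 < lam" and "0 < \<beta>" and "\<beta> < 1"
    and "is_tempered_stable \<alpha> \<beta> lam \<eta>"
  shows "\<exists>g. is_density_of g \<eta> \<and> C_infinity g \<and>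
    (\<exists>x0>0.
      (\<forall>x\<le>0. deriv g x = 0) \<and>
      (\<forall>x\<in>{0<..<x0}. deriv g x > 0) \<and>
      deriv g x0 = 0 \<and>
      (\<forall>x\<in>{x0<..}. deriv g x < 0) \<and>
      (\<exists>\<xi>0>0.
        \<alpha> powr (1 / \<beta>) * exp (- (lam / \<beta>) * \<xi>0) = \<xi>0 \<and>
        (\<forall>\<xi>>0. \<alpha> powr (1 / \<beta>) * exp (- (lam / \<beta>) * \<xi>) = \<xi> \<longrightarrow> \<xi> = \<xi>0) \<and>
        max (Gamma (1 - \<beta>) * (\<alpha> / lam powr (1 - \<beta>))
               - sqrt (3 * Gamma (2 - \<beta>) * (\<alpha> / lam powr (2 - \<beta>))))
            \<xi>0 < x0 \<and>
        x0 < min (Gamma (1 - \<beta>) * (\<alpha> / lam powr (1 - \<beta>)))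
                 ((\<alpha> / (1 - \<beta>)) powr (1 / \<beta>))))"
proof -
  interpret ts_parameters \<alpha> \<beta> lam
    using assms by unfold_locales
  have "real_distribution \<eta>"
    using assms(5) by (simp add: is_tempered_stable_def infinitely_divisible_def)
  moreover have "char \<eta> = \<phi>"
  proof
    fix z
    have "char \<eta> z = exp (CLINT x | ts_levy_measure \<alpha> \<beta> lam. (iexp (z * x) - 1))"
      using assms(5) unfolding is_tempered_stable_def by blast
    then show "char \<eta> z = \<phi> z"
      by (simp only: ts_levy_measure_integral \<phi>_def)
  qed
  ultimately interpret ts_distribution \<alpha> \<beta> lam \<eta>
    by (auto intro!: ts_distribution.intro ts_distribution_axioms.intro ts_parameters_axioms)
  obtain \<xi> where \<xi>: "0 < \<xi>" "k \<xi> = 1"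
    using fixed_point_exists by blast
  have \<xi>_unique: "\<zeta> = \<xi>" if "0 < \<zeta>" "k \<zeta> = 1" for \<zeta>
    using k_strict_antimono[of \<zeta> \<xi>] k_strict_antimono[of \<xi> \<zeta>] that \<xi> by (cases \<zeta> \<xi> rule: linorder_cases) auto
  interpret convolution_density k "G 0" "G (Suc 0)" \<xi>
  proof
    show "0 < k y" if "0 < y" for y
      using that alpha_pos by (simp add: k_def)
    show "continuous_on UNIV (G (Suc 0))"
      using G_deriv by (intro continuous_at_imp_continuous_on ballI DERIV_isCont)
    show "integrable lborel (G 0)" "integral\<^sup>L lborel (G 0) = 1"
      using G_has_integral by (auto simp: has_bochner_integral_iff)
  qed (fact k_zero k_strict_antimono k_integrable \<xi> G_deriv G_nonneg G_zero G_conv G_conv'[unfolded One_nat_def])+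
  obtain M where M: "first_critical M"
    using first_critical_exists by blast
  then have "\<xi> < M" "0 < M" using \<xi>(1) by (auto simp: first_critical_def)
  have deriv: "deriv (G 0) x = G (Suc 0) x" for x
    by (rule DERIV_imp_deriv[OF G_deriv])
  have mass: "M < (\<integral>y. k y * indicator {0<..<M} y \<partial>lborel)"
    using M by (rule first_critical_less_kernel_mass)
  have mean: "integral\<^sup>L lborel k = Gamma (1 - \<beta>) * (\<alpha> / lam powr (1 - \<beta>))"
    using k_has_integral by (simp add: has_bochner_integral_iff)
  have var: "(\<integral>y. y * k y \<partial>lborel) = Gamma (2 - \<beta>) * (\<alpha> / lam powr (2 - \<beta>))"
    and yk: "integrable lborel (\<lambda>y. y * k y)"
    using times_k_has_integral by (auto simp: has_bochner_integral_iff)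
  have upper1: "M < Gamma (1 - \<beta>) * (\<alpha> / lam powr (1 - \<beta>))"
  proof -
    have "(\<integral>y. k y * indicator {0<..<M} y \<partial>lborel) \<le> integral\<^sup>L lborel k"
      using k_nonneg by (intro integral_mono k_integrable k_indicator_integrable) (auto simp: indicator_def)
    with mass mean show ?thesis by simp
  qed
  have upper2: "M < (\<alpha> / (1 - \<beta>)) powr (1 / \<beta>)"
  proof -
    have "M < \<alpha> * (M powr (1 - \<beta>) / (1 - \<beta>))"
      using mass k_initial_integral_le[of M] \<open>0 < M\<close> by simp
    also have "\<dots> = M * (\<alpha> / (1 - \<beta>)) / M powr \<beta>"
      using \<open>0 < M\<close> by (simp add: powr_diff mult_ac)
    finally have "M * M powr \<beta> < M * (\<alpha> / (1 - \<beta>))"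
      using \<open>0 < M\<close> by (simp only: pos_less_divide_eq powr_gt_zero)
    then have "M powr \<beta> < \<alpha> / (1 - \<beta>)"
      using \<open>0 < M\<close> by (simp only: mult_less_cancel_left_pos)
    then have "(M powr \<beta>) powr (1 / \<beta>) < (\<alpha> / (1 - \<beta>)) powr (1 / \<beta>)"
      using beta_pos by (intro powr_less_mono2) auto
    then show ?thesis using \<open>0 < M\<close> beta_pos by (simp add: powr_powr)
  qed
  have lower: "Gamma (1 - \<beta>) * (\<alpha> / lam powr (1 - \<beta>))
      - sqrt (3 * Gamma (2 - \<beta>) * (\<alpha> / lam powr (2 - \<beta>))) < M"
    using real_less_rsqrt[OF mode_mean_distance[OF M yk]] unfolding mean var by (simp add: mult.assoc)
  have bounds: "\<exists>\<xi>0>0. \<alpha> powr (1 / \<beta>) * exp (- (lam / \<beta>) * \<xi>0) = \<xi>0 \<and>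
      (\<forall>\<xi>>0. \<alpha> powr (1 / \<beta>) * exp (- (lam / \<beta>) * \<xi>) = \<xi> \<longrightarrow> \<xi> = \<xi>0) \<and>
      max (Gamma (1 - \<beta>) * (\<alpha> / lam powr (1 - \<beta>))
             - sqrt (3 * Gamma (2 - \<beta>) * (\<alpha> / lam powr (2 - \<beta>)))) \<xi>0 < M \<and>
      M < min (Gamma (1 - \<beta>) * (\<alpha> / lam powr (1 - \<beta>))) ((\<alpha> / (1 - \<beta>)) powr (1 / \<beta>))"
  proof (intro exI[of _ \<xi>] conjI allI impI)
    show "\<alpha> powr (1 / \<beta>) * exp (- (lam / \<beta>) * \<xi>) = \<xi>"
      using \<xi> k_eq_1_iff by blast
    show "\<zeta> = \<xi>" if "0 < \<zeta>" "\<alpha> powr (1 / \<beta>) * exp (- (lam / \<beta>) * \<zeta>) = \<zeta>" for \<zeta>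
      using that k_eq_1_iff \<xi>_unique by blast
  qed (use \<xi>(1) \<open>\<xi> < M\<close> lower upper1 upper2 in simp_all)
  show ?thesis
  proof (rule exI[of _ "G 0"], intro conjI is_density_of_G G_C_infinity, rule exI[of _ M],
      intro conjI allI ballI impI bounds \<open>0 < M\<close>)
    show "deriv (G 0) x = 0" if "x \<le> 0" for x
      using that by (simp add: deriv g'_zero)
    show "deriv (G 0) x > 0" if "x \<in> {0<..<M}" for x
      using M that by (simp add: deriv first_critical_def)
    show "deriv (G 0) M = 0"
      using M by (simp add: deriv first_critical_def)
    show "deriv (G 0) x < 0" if "x \<in> {M<..}" for x
      using g'_neg_above[OF M] that by (simp add: deriv)
  qed
qed

end
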